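(* Let $q>2$ be a prime power and let $\omega=x^M$ be the power word with $M=q-1$. Then for any $N$ and any $c>0$ there exists an integer $n\geqslant 2$ such that $G=\mathrm{PSL}_n(q)$ satisfies $|G|\geqslant N$ and $$|\omega(G)|<c\,|G|.$$
   Context: $\mathrm{PSL}_n(q)$ is the projective special linear group over the field $\mathbb{F}_q$ of $q$ elements. For the word $\omega=x^M$ and a group $G$, $\omega(G)=\{g^M : g\in G\}$ is the image of the $M$-th power map. A power word is a word of the form $\upsilon^m$ with $m>1$. *)

theory Defs
  imports
    "Jordan_Normal_Form.Determinant"
    "HOL-Algebra.Coset"
    "HOL-Number_Theory.Prime_Powers"
    "HOL-Library.Cardinality"
begin

definition SL :: "nat \<Rightarrow> 'a :: field mat monoid" where
  "SL n = \<lparr>carrier = {A \<in> carrier_mat n n. det A = 1}, mult = (*), one = 1\<^sub>m n\<rparr>"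

definition group_center :: "('g, 'h) monoid_scheme \<Rightarrow> 'g set" where
  "group_center G = {z \<in> carrier G. \<forall>g\<in>carrier G. z \<otimes>\<^bsub>G\<^esub> g = g \<otimes>\<^bsub>G\<^esub> z}"

definition PSL :: "nat \<Rightarrow> 'a :: field mat set monoid" where
  "PSL n = SL n Mod group_center (SL n)"

definition power_word_image :: "nat \<Rightarrow> ('g, 'h) monoid_scheme \<Rightarrow> 'g set" where
  "power_word_image M G = {g [^]\<^bsub>G\<^esub> M | g. g \<in> carrier G}"

lemma group_SL: "group (SL n :: 'a :: field mat monoid)"
proof (rule groupI)
  fix A :: "'a mat"
  assume "A \<in> carrier (SL n)"
  then have A: "A \<in> carrier_mat n n" and d: "det A = 1"
    by (auto simp: SL_def)
  have adj: "adj_mat A \<in> carrier_mat n n" "adj_mat A * A = 1\<^sub>m n"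
    using adj_mat[OF A] d by auto
  then have "det (adj_mat A) * det A = 1"
    using det_mult[OF adj(1) A] by simp
  with adj d show "\<exists>B\<in>carrier (SL n). B \<otimes>\<^bsub>SL n\<^esub> A = \<one>\<^bsub>SL n\<^esub>"
    by (auto simp: SL_def)
qed (auto simp: SL_def det_mult)

lemma (in group) group_center_normal: "group_center G \<lhd> G"
proof -
  have "subgroup (group_center G) G"
  proof (rule subgroupI)
    show "group_center G \<subseteq> carrier G"
      by (auto simp: group_center_def)
    show "group_center G \<noteq> {}"
    proof -
      have "\<one> \<in> group_center G"
        by (simp add: group_center_def)
      then show ?thesis by blast
    qed
  next
    fix a assume "a \<in> group_center G"
    then have a: "a \<in> carrier G" "\<And>g. g \<in> carrier G \<Longrightarrow> a \<otimes> g = g \<otimes> a"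
      unfolding group_center_def by blast+
    have "inv a \<otimes> g = g \<otimes> inv a" if g: "g \<in> carrier G" for g
    proof -
      have "inv a \<otimes> g = inv a \<otimes> (g \<otimes> a) \<otimes> inv a"
        using g a(1) by (simp add: m_assoc)
      also have "\<dots> = g \<otimes> inv a"
        using g a(1) by (simp add: a(2)[OF g, symmetric] m_assoc[symmetric])
      finally show ?thesis .
    qed
    with a(1) show "inv a \<in> group_center G"
      by (simp add: group_center_def)
  next
    fix a b assume "a \<in> group_center G" "b \<in> group_center G"
    then have a: "a \<in> carrier G" "\<And>g. g \<in> carrier G \<Longrightarrow> a \<otimes> g = g \<otimes> a"
      and b: "b \<in> carrier G" "\<And>g. g \<in> carrier G \<Longrightarrow> b \<otimes> g = g \<otimes> b"
      unfolding group_center_def by blast+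
    have "a \<otimes> b \<otimes> g = g \<otimes> (a \<otimes> b)" if g: "g \<in> carrier G" for g
    proof -
      have "a \<otimes> b \<otimes> g = a \<otimes> (g \<otimes> b)"
        using a(1) b g by (simp add: m_assoc)
      also have "\<dots> = g \<otimes> a \<otimes> b"
        using a(1) b(1) g a(2)[OF g] by (metis m_assoc)
      finally show ?thesis
        using a(1) b(1) g by (simp add: m_assoc)
    qed
    with a(1) b(1) show "a \<otimes> b \<in> group_center G"
      by (simp add: group_center_def)
  qed
  moreover have "x \<otimes> h \<otimes> inv x \<in> group_center G"
    if "x \<in> carrier G" "h \<in> group_center G" for x h
  proof -
    have "h \<in> carrier G" "x \<otimes> h = h \<otimes> x"
      using that unfolding group_center_def by force+
    then have "x \<otimes> h \<otimes> inv x = h"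
      using that by (simp add: m_assoc)
    with that show ?thesis by simp
  qed
  ultimately show ?thesis
    by (auto simp: normal_inv_iff)
qed

lemma group_PSL: "group (PSL n :: 'a :: field mat set monoid)"
  unfolding PSL_def
  by (intro normal.factorgroup_is_group group.group_center_normal group_SL)

end

theory Submission
  imports Defs "Jordan_Normal_Form.Column_Operations"
begin

text \<open>
  Put \<open>q = CARD('a)\<close>. If \<open>B \<in> SL n\<close> commutes with many \<open>z\<close> satisfying \<open>z ^ (q - 1) = 1\<close>, then the
  fibre of the power map through \<open>B\<close> is large, as \<open>(B z) ^ (q - 1) = B ^ (q - 1)\<close>. When \<open>K\<close> distinct
  monic irreducible polynomials divide the characteristic polynomial of \<open>B\<close>, each union of primary
  components gives an idempotent polynomial in \<open>B\<close>, and scaling by a fixed \<open>l \<noteq> 0, 1\<close> on it yields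
  \<open>2 ^ K\<close> such \<open>z\<close>. So it suffices that most \<open>B\<close> have many irreducible factors.

  For an irreducible \<open>f\<close> let \<open>X f B\<close> count the embeddings of the module \<open>F[x]/(f)\<close> into the module
  \<open>F ^ n\<close> defined by \<open>B\<close>. Since \<open>SL n\<close> is transitive on injective \<open>n\<close> by \<open>k\<close> matrices for \<open>k < n\<close>,
  \<open>X f\<close> has mean exactly 1, \<open>X f * X g\<close> has mean at most 1 for \<open>f \<noteq> g\<close>, and \<open>(X f)^2\<close> has mean at
  most \<open>1 + q ^ deg f\<close>. As \<open>\<Sum>f. 1 / q ^ deg f\<close> diverges, Chebyshev's inequality applies to arbitrarily
  many disjoint families of irreducible polynomials.
\<close>

section \<open>Monic irreducible polynomials over a finite field\<close>

text \<open>The Euclidean algorithm: the pair \<open>(a, b)\<close> is replaced by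
  \<open>(b, a mod b)\<close> until \<open>b = 0\<close>, and the remainder is substituted back into
  the combination.\<close>

lemma bezout_poly:
  fixes a b :: "'a :: field poly"
  assumes "coprime a b"
  shows "\<exists>u w. u * a + w * b = 1"
  using assms
proof (induction "euclidean_size b" arbitrary: a b rule: less_induct)
  case less
  show ?case
  proof (cases "b = 0")
    case True
    with less.prems have "a dvd 1" by simp
    then show ?thesis
      using True by (metis add.right_neutral dvdE mult.commute mult_zero_right)
  next
    case False
    have "coprime b (a mod b)"
      using less.prems False by (simp add: coprime_commute)
    moreover have "euclidean_size (a mod b) < euclidean_size b"
      using False by (rule mod_size_less)
    ultimately obtain u w where uw: "u * b + w * (a mod b) = 1"
      using less.hyps by blast
    have "a mod b = a - a div b * b"
      by (simp add: minus_div_mult_eq_mod)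
    with uw have "w * a + (u - w * (a div b)) * b = 1"
      by (simp add: algebra_simps)
    then show ?thesis by blast
  qed
qed

lemma coprime_dvd_mult_poly:
  fixes a b c :: "'a :: field poly"
  assumes "coprime a b" "a dvd b * c"
  shows "a dvd c"
proof -
  obtain u w where "u * a + w * b = 1" using bezout_poly[OF assms(1)] by blast
  then have "c = (u * a + w * b) * c" by simp
  then have "c = a * (u * c) + w * (b * c)" by (simp only: algebra_simps)
  with assms(2) show ?thesis by (metis dvd_add dvd_mult dvd_triv_left)
qed

lemma irreducible_dvd_poly_exists:
  fixes p :: "'a :: field poly"
  assumes "degree p > 0"
  shows "\<exists>f. irreducible f \<and> lead_coeff f = 1 \<and> f dvd p"
  using assms
proof (induction "degree p" arbitrary: p rule: less_induct)
  case less
  show ?case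
  proof (cases "irreducible p")
    case True
    define f where "f = smult (inverse (lead_coeff p)) p"
    have "p \<noteq> 0" using less.prems by auto
    then have "is_unit [:inverse (lead_coeff p):]"
      by (simp add: is_unit_const_poly_iff dvd_field_iff)
    moreover have f: "f = [:inverse (lead_coeff p):] * p"
      by (simp add: f_def)
    ultimately have "irreducible f"
      using True by (simp only: irreducible_mult_unit_left)
    moreover have "f dvd p"
      using \<open>p \<noteq> 0\<close> by (simp add: f_def smult_dvd)
    moreover have "lead_coeff f = 1"
      using \<open>p \<noteq> 0\<close> by (simp add: f_def)
    ultimately show ?thesis by blast
  next
    case False
    have "p \<noteq> 0" using less.prems by auto
    then have "\<not> is_unit p"
      using less.prems by (simp add: is_unit_iff_degree)
    with False \<open>p \<noteq> 0\<close> obtain a b where ab: "p = a * b" "\<not> is_unit a" "\<not> is_unit b"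
      by (auto simp: irreducible_def)
    then have "a \<noteq> 0" "b \<noteq> 0" using \<open>p \<noteq> 0\<close> by auto
    with ab have "degree a > 0" "degree b > 0"
      by (auto simp: is_unit_iff_degree)
    moreover from this have "degree a < degree p"
      using ab \<open>a \<noteq> 0\<close> \<open>b \<noteq> 0\<close> by (simp add: degree_mult_eq)
    ultimately show ?thesis
      using less.hyps[of a] ab(1) by (metis dvd_mult2)
  qed
qed

definition monic_irreducibles :: "'a :: field poly set" where
  "monic_irreducibles = {f. irreducible f \<and> lead_coeff f = 1}"

lemma monic_irreducibles_degree: "f \<in> monic_irreducibles \<Longrightarrow> degree f > 0"
  using is_unit_iff_degree[of f]
  by (auto simp: monic_irreducibles_def irreducible_not_unit intro: Nat.gr0I)

lemma coprime_monic_irreducible: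
  assumes "f \<in> monic_irreducibles" "\<not> f dvd b"
  shows "coprime f b"
proof (rule coprimeI)
  fix c assume c: "c dvd f" "c dvd b"
  from c(1) obtain d where d: "f = c * d" by blast
  then have "is_unit c \<or> is_unit d"
    using assms(1) by (auto simp: monic_irreducibles_def dest: irreducibleD)
  moreover have "\<not> is_unit d"
    using d c(2) assms(2) by auto
  ultimately show "is_unit c" by blast
qed

lemma monic_irreducibles_dvd_imp_eq:
  assumes "f \<in> monic_irreducibles" "g \<in> monic_irreducibles" "f dvd g"
  shows "f = g"
proof -
  obtain d where d: "g = f * d" using assms(3) by blast
  have "\<not> is_unit f" using assms(1) by (simp add: monic_irreducibles_def irreducible_not_unit)
  then have "is_unit d"
    using d assms(2) by (auto simp: monic_irreducibles_def dest: irreducibleD)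
  then obtain c where "d = [:c:]" by (auto simp: is_unit_poly_iff)
  moreover have "lead_coeff d = 1"
    using assms d by (simp add: monic_irreducibles_def lead_coeff_mult)
  ultimately show ?thesis using d by (simp add: one_pCons[symmetric])
qed

text \<open>Irreducible factors of \<open>h\<close> are peeled off one at a time and put into
  \<open>a\<close> or \<open>b\<close> according to membership in \<open>S\<close>. A common factor
  of positive degree would have a monic irreducible divisor both in and outside \<open>S\<close>, so
  the two parts are coprime. Varying \<open>S\<close> singles out arbitrary unions of primary
  components.\<close>

lemma coprime_splitting:
  fixes h :: "'a :: field poly"
  assumes "h \<noteq> 0"
  shows "\<exists>a b. h = a * b \<and> coprime a b \<and>
    (\<forall>f\<in>monic_irreducibles. f dvd a \<longrightarrow> f \<in> S) \<and>
    (\<forall>f\<in>monic_irreducibles. f dvd b \<longrightarrow> f \<notin> S)"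
proof -
  have "\<exists>a b. h = a * b \<and>
    (\<forall>f\<in>monic_irreducibles. f dvd a \<longrightarrow> f \<in> S) \<and>
    (\<forall>f\<in>monic_irreducibles. f dvd b \<longrightarrow> f \<notin> S)"
    using assms
  proof (induction "degree h" arbitrary: h rule: less_induct)
    case less
    show ?case
    proof (cases "degree h > 0")
      case False
      then have "is_unit h" using less.prems by (simp add: is_unit_iff_degree)
      then have "\<not> f dvd h" "\<not> f dvd 1" if "f \<in> monic_irreducibles" for f
        using that dvd_unit_imp_unit[of f h]
        by (auto simp: monic_irreducibles_def irreducible_not_unit)
      then show ?thesis by (metis mult.right_neutral)
    next
      case True
      obtain f where f: "f \<in> monic_irreducibles" "f dvd h"
        using irreducible_dvd_poly_exists[OF True] by (auto simp: monic_irreducibles_def)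
      then obtain k where k: "h = f * k" by blast
      have "f \<noteq> 0" "k \<noteq> 0" using k less.prems by auto
      then have "degree k < degree h"
        using k monic_irreducibles_degree[OF f(1)] by (simp add: degree_mult_eq)
      from less.hyps[OF this \<open>k \<noteq> 0\<close>] obtain a b where ab: "k = a * b"
        "\<forall>f\<in>monic_irreducibles. f dvd a \<longrightarrow> f \<in> S"
        "\<forall>f\<in>monic_irreducibles. f dvd b \<longrightarrow> f \<notin> S" by (elim exE conjE) (rule that)
      \<comment> \<open>Monic irreducibles are prime, so multiplying by \<open>f\<close> adds only
        \<open>f\<close> itself to the monic irreducible divisors.\<close>
      have *: "g = f \<or> g dvd c" if "g \<in> monic_irreducibles" "g dvd f * c" for g c
      proof (cases "g dvd f")
        case True
        then show ?thesis using monic_irreducibles_dvd_imp_eq[OF that(1) f(1)] by simp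
      next
        case False
        then have "coprime g f" by (rule coprime_monic_irreducible[OF that(1)])
        then show ?thesis using that(2) coprime_dvd_mult_poly by blast
      qed
      show ?thesis
      proof (cases "f \<in> S")
        case True
        have "h = (f * a) * b" using k ab by (simp add: mult_ac)
        with True ab * show ?thesis by metis
      next
        case False
        have "h = a * (f * b)" using k ab by (simp add: mult_ac)
        with False ab * show ?thesis by metis
      qed
    qed
  qed
  then obtain a b where ab: "h = a * b"
    "\<forall>f\<in>monic_irreducibles. f dvd a \<longrightarrow> f \<in> S"
    "\<forall>f\<in>monic_irreducibles. f dvd b \<longrightarrow> f \<notin> S" by (elim exE conjE) (rule that)
  have "coprime a b"
  proof (rule coprimeI)
    fix c assume c: "c dvd a" "c dvd b"
    have "c \<noteq> 0" using c ab(1) assms by auto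
    show "is_unit c"
    proof (rule ccontr)
      assume "\<not> is_unit c"
      then have "degree c > 0" using \<open>c \<noteq> 0\<close> by (simp add: is_unit_iff_degree)
      then obtain f where "f \<in> monic_irreducibles" "f dvd c"
        using irreducible_dvd_poly_exists by (auto simp: monic_irreducibles_def)
      with c ab show False by (meson dvd_trans)
    qed
  qed
  with ab show ?thesis by blast
qed

section \<open>Counting monic polynomials, and divergence of the reciprocal sum\<close>

definition monics :: "nat \<Rightarrow> 'a :: field poly set" where
  "monics m = {p. degree p = m \<and> lead_coeff p = 1}"

lemma monics_card:
  "finite (monics m :: 'a :: {field, finite} poly set)"
  "card (monics m :: 'a :: {field, finite} poly set) = CARD('a) ^ m"
proof (induction m)
  case 0
  have "monics 0 = {1 :: 'a poly}"
    by (auto simp: monics_def elim!: degree_eq_zeroE)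
  then show "finite (monics 0 :: 'a poly set)" "card (monics 0 :: 'a poly set) = CARD('a) ^ 0"
    by auto
next
  case (Suc m)
  have eq: "monics (Suc m) = (\<lambda>(a, p :: 'a poly). pCons a p) ` (UNIV \<times> monics m)"
  proof (intro equalityI subsetI)
    fix p :: "'a poly" assume p: "p \<in> monics (Suc m)"
    obtain a r where r: "p = pCons a r" by (cases p)
    with p have "r \<noteq> 0" by (auto simp: monics_def)
    with p r have "r \<in> monics m" by (auto simp: monics_def)
    with r show "p \<in> (\<lambda>(a, p). pCons a p) ` (UNIV \<times> monics m)" by auto
  qed (auto simp: monics_def)
  have inj: "inj_on (\<lambda>(a, p :: 'a poly). pCons a p) (UNIV \<times> monics m)"
    by (auto simp: inj_on_def)
  show "finite (monics (Suc m) :: 'a poly set)"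
    using Suc by (simp add: eq)
  show "card (monics (Suc m) :: 'a poly set) = CARD('a) ^ Suc m"
    using Suc inj by (simp add: eq card_image card_cartesian_product)
qed

lemma finite_monic_degree_le:
  "finite {g :: 'a :: {field, finite} poly. lead_coeff g = 1 \<and> degree g \<le> D}"
proof -
  have "{g :: 'a poly. lead_coeff g = 1 \<and> degree g \<le> D} = (\<Union>m\<le>D. monics m)"
    by (auto simp: monics_def)
  then show ?thesis by (simp add: monics_card)
qed

text \<open>In \<open>g = f ^ j * h\<close> with \<open>h\<close> not divisible by \<open>f\<close>,
  the degree forces \<open>j \<le> D\<close>, so each element of \<open>T\<close> contributes at
  most \<open>D + 1\<close> choices of exponent. The bound is polynomial in \<open>D\<close>,
  whereas the number of monic polynomials grows exponentially.\<close>

lemma smooth_card: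
  fixes T :: "'a :: {field, finite} poly set"
  assumes "finite T" "T \<subseteq> monic_irreducibles"
  shows "card {g. lead_coeff g = 1 \<and> degree g \<le> D \<and> (\<forall>f\<in>monic_irreducibles. f dvd g \<longrightarrow> f \<in> T)}
    \<le> (D + 1) ^ card T"
  using assms
proof (induction T rule: finite_induct)
  case empty
  have "g = 1" if g: "lead_coeff g = 1" "\<forall>f\<in>monic_irreducibles. \<not> f dvd g" for g :: "'a poly"
  proof -
    have "degree g = 0"
      using irreducible_dvd_poly_exists[of g] g by (auto simp: monic_irreducibles_def)
    then show ?thesis using g by (auto elim!: degree_eq_zeroE)
  qed
  then have "{g :: 'a poly. lead_coeff g = 1 \<and> degree g \<le> D \<and> (\<forall>f\<in>monic_irreducibles. f dvd g \<longrightarrow> f \<in> {})} \<subseteq> {1}"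
    by auto
  from card_mono[OF _ this] show ?case by simp
next
  case (insert f T)
  let ?S = "\<lambda>T. {g :: 'a poly. lead_coeff g = 1 \<and> degree g \<le> D \<and> (\<forall>f\<in>monic_irreducibles. f dvd g \<longrightarrow> f \<in> T)}"
  have f: "f \<in> monic_irreducibles" "lead_coeff f = 1" "degree f > 0"
    using insert.prems monic_irreducibles_degree[of f] by (auto simp: monic_irreducibles_def)
  have split: "\<exists>j h. g = f ^ j * h \<and> \<not> f dvd h" if "g \<noteq> 0" for g
    using that
  proof (induction "degree g" arbitrary: g rule: less_induct)
    case less
    show ?case
    proof (cases "f dvd g")
      case False
      then show ?thesis by (metis mult_1 power_0)
    next
      case True
      then obtain k where k: "g = f * k" by blast
      have "f \<noteq> 0" "k \<noteq> 0" using k less.prems by auto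
      then have "degree k < degree g"
        using k f(3) by (simp add: degree_mult_eq)
      from less.hyps[OF this \<open>k \<noteq> 0\<close>] obtain j h where "k = f ^ j * h" "\<not> f dvd h"
        by blast
      with k have "g = f ^ Suc j * h \<and> \<not> f dvd h" by (simp add: mult_ac)
      then show ?thesis by blast
    qed
  qed
  have sub: "?S (insert f T) \<subseteq> (\<lambda>(j, h). f ^ j * h) ` ({..D} \<times> ?S T)"
  proof
    fix g assume g: "g \<in> ?S (insert f T)"
    then have "g \<noteq> 0" by auto
    with split obtain j h where jh: "g = f ^ j * h" "\<not> f dvd h" by blast
    with \<open>g \<noteq> 0\<close> have "h \<noteq> 0" "f \<noteq> 0" using f(2) by auto
    have "degree g \<le> D" using g by simp
    from \<open>h \<noteq> 0\<close> \<open>f \<noteq> 0\<close> have deg: "degree g = j * degree f + degree h"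
      using jh(1) by (simp add: degree_mult_eq degree_power_eq)
    have "lead_coeff h = 1"
      using g jh f(2) by (simp add: lead_coeff_mult lead_coeff_power)
    moreover have "degree h \<le> D" using g deg by simp
    moreover have "j \<le> j * degree f" using f(3) by simp
    then have "j \<le> D" using deg \<open>degree g \<le> D\<close> by linarith
    moreover have "e \<in> T" if "e \<in> monic_irreducibles" "e dvd h" for e
      using that g jh by auto
    ultimately show "g \<in> (\<lambda>(j, h). f ^ j * h) ` ({..D} \<times> ?S T)"
      using jh(1) by force
  qed
  have fin: "finite (?S T)"
    by (rule finite_subset[OF _ finite_monic_degree_le[of D]]) auto
  have "card (?S (insert f T)) \<le> card ((\<lambda>(j, h). f ^ j * h) ` ({..D} \<times> ?S T))"
    using fin by (intro card_mono[OF _ sub]) auto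
  also have "\<dots> \<le> card ({..D} \<times> ?S T)"
    using fin by (intro card_image_le) auto
  also have "\<dots> = (D + 1) * card (?S T)"
    by (simp add: card_cartesian_product)
  also have "\<dots> \<le> (D + 1) * (D + 1) ^ card T"
    using insert by (intro mult_left_mono) auto
  also have "\<dots> = (D + 1) ^ card (insert f T)"
    using insert by simp
  finally show ?case .
qed

lemma power_dominated_by_exp: "\<exists>D :: nat. 2 * (D + 1) ^ k \<le> 2 ^ D"
proof -
  \<comment> \<open>The witness is \<open>D = 2 ^ m\<close>: then
    \<open>D + 1 \<le> 2 ^ (m + 1)\<close>, and it suffices that
    \<open>1 + (m + 1) * k \<le> 2 ^ m\<close>. The value \<open>2 * k + 4\<close> puts the left
    side below \<open>m * m\<close>, and \<open>m \<ge> 4\<close> puts \<open>m * m\<close> below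
    \<open>2 ^ m\<close>.\<close>
  define m where "m = 2 * k + 4"
  have sq: "m * m \<le> 2 ^ m" if "m \<ge> 4" for m :: nat
    using that
  proof (induction m rule: dec_induct)
    case (step m)
    have "Suc m * Suc m = m * m + 2 * m + 1" by simp
    also have "\<dots> \<le> m * m + m * m"
    proof -
      have "4 * m \<le> m * m" using step by (intro mult_right_mono) auto
      then show ?thesis using step by linarith
    qed
    finally show ?case using step by simp
  qed simp
  have "1 + (m + 1) * k \<le> m * m"
    by (simp add: m_def algebra_simps)
  also have "\<dots> \<le> 2 ^ m" using sq[of m] by (simp add: m_def)
  finally have le: "1 + (m + 1) * k \<le> 2 ^ m" .
  have "(2 ^ m + 1 :: nat) \<le> 2 ^ (m + 1)" by simp
  then have "(2 ^ m + 1 :: nat) ^ k \<le> (2 ^ (m + 1)) ^ k" by (rule power_mono) simp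
  then have "2 * (2 ^ m + 1 :: nat) ^ k \<le> 2 ^ (1 + (m + 1) * k)"
    by (simp add: power_mult power_add)
  also have "\<dots> \<le> 2 ^ (2 ^ m)" using le by (rule power_increasing) simp
  finally show ?thesis by blast
qed

text \<open>Erdos' argument for the divergence of the sum of the reciprocals of the primes: few polynomials
  are products of elements of \<open>T0\<close>, so the multiples of the remaining irreducibles must cover half
  of all monic polynomials of degree \<open>D\<close>.\<close>

lemma irreducibles_mass_half:
  fixes T0 :: "'a :: {field, finite} poly set"
  assumes "finite T0" "T0 \<subseteq> monic_irreducibles"
  shows "\<exists>T. finite T \<and> T \<subseteq> monic_irreducibles \<and> T \<inter> T0 = {} \<and>
    (\<Sum>f\<in>T. 1 / real CARD('a) ^ degree f) \<ge> 1 / 2"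
proof -
  let ?q = "CARD('a)"
  have "card {0 :: 'a, 1} \<le> ?q" by (intro card_mono) auto
  then have q: "?q \<ge> 2" by simp
  \<comment> \<open>For this \<open>D\<close> the bound of \<open>smooth_card\<close> is at most
    half of the \<open>q ^ D\<close> monic polynomials of degree \<open>D\<close>.\<close>
  obtain D where "2 * (D + 1) ^ card T0 \<le> 2 ^ D" using power_dominated_by_exp by blast
  also have "\<dots> \<le> ?q ^ D" using q by (intro power_mono) auto
  finally have D: "2 * (D + 1) ^ card T0 \<le> ?q ^ D" .
  define T where "T = {f \<in> monic_irreducibles. degree f \<le> D} - T0"
  define Sm where "Sm = {g :: 'a poly. lead_coeff g = 1 \<and> degree g \<le> D \<and>
    (\<forall>f\<in>monic_irreducibles. f dvd g \<longrightarrow> f \<in> T0)}"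
  have finT: "finite T"
    by (rule finite_subset[OF _ finite_monic_degree_le[of D]]) (auto simp: T_def monic_irreducibles_def)
  have finS: "finite Sm"
    by (rule finite_subset[OF _ finite_monic_degree_le[of D]]) (auto simp: Sm_def)
  have sub: "monics D \<subseteq> Sm \<union> (\<Union>f\<in>T. (\<lambda>h. f * h) ` monics (D - degree f))"
  proof
    fix g :: "'a poly" assume g: "g \<in> monics D"
    show "g \<in> Sm \<union> (\<Union>f\<in>T. (\<lambda>h. f * h) ` monics (D - degree f))"
    proof (cases "g \<in> Sm")
      case False
      then obtain f where f: "f \<in> monic_irreducibles" "f dvd g" "f \<notin> T0"
        using g by (auto simp: Sm_def monics_def)
      then obtain h where h: "g = f * h" by blast
      have "g \<noteq> 0" using g by (auto simp: monics_def)
      with h have "f \<noteq> 0" "h \<noteq> 0" by auto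
      with h have "degree g = degree f + degree h" by (simp add: degree_mult_eq)
      moreover have "lead_coeff h = 1"
        using h f g by (simp add: lead_coeff_mult monics_def monic_irreducibles_def)
      ultimately have "f \<in> T" "h \<in> monics (D - degree f)"
        using f g by (auto simp: T_def monics_def)
      then show ?thesis using h by blast
    qed simp
  qed
  have "?q ^ D = card (monics D :: 'a poly set)"
    by (simp add: monics_card)
  also have "\<dots> \<le> card (Sm \<union> (\<Union>f\<in>T. (\<lambda>h. f * h) ` monics (D - degree f)))"
    using finT finS by (intro card_mono[OF _ sub]) (auto simp: monics_card)
  also have "\<dots> \<le> card Sm + card (\<Union>f\<in>T. (\<lambda>h. f * h) ` monics (D - degree f))"
    by (rule card_Un_le)
  also have "\<dots> \<le> card Sm + (\<Sum>f\<in>T. card ((\<lambda>h. f * h) ` (monics (D - degree f))))"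
    using finT by (intro add_left_mono card_UN_le)
  also have "\<dots> \<le> (D + 1) ^ card T0 + (\<Sum>f\<in>T. ?q ^ (D - degree f))"
  proof (intro add_mono sum_mono)
    show "card Sm \<le> (D + 1) ^ card T0"
      unfolding Sm_def by (rule smooth_card[OF assms])
    show "card ((\<lambda>h. f * h) ` (monics (D - degree f))) \<le> ?q ^ (D - degree f)" for f :: "'a poly"
      using card_image_le[OF monics_card(1), of "\<lambda>h. f * h"] by (simp add: monics_card)
  qed
  finally have "2 * ?q ^ D \<le> ?q ^ D + 2 * (\<Sum>f\<in>T. ?q ^ (D - degree f))"
    using D by linarith
  then have "?q ^ D \<le> 2 * (\<Sum>f\<in>T. ?q ^ (D - degree f))" by linarith
  then have "real (?q ^ D) \<le> real (2 * (\<Sum>f\<in>T. ?q ^ (D - degree f)))"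
    by (simp only: of_nat_le_iff)
  also have "\<dots> = 2 * (\<Sum>f\<in>T. real ?q ^ D * (1 / real ?q ^ degree f))"
  proof -
    \<comment> \<open>Elements of \<open>T\<close> have degree at most \<open>D\<close>, so the
      natural number subtraction in the exponent is not truncated.\<close>
    have "real ?q ^ (D - degree f) = real ?q ^ D * (1 / real ?q ^ degree f)" if "f \<in> T" for f
      using that q by (simp add: T_def power_diff)
    then show ?thesis by simp
  qed
  also have "\<dots> = real ?q ^ D * (2 * (\<Sum>f\<in>T. 1 / real ?q ^ degree f))"
    by (simp add: sum_distrib_left mult_ac)
  finally have "1 \<le> 2 * (\<Sum>f\<in>T. 1 / real ?q ^ degree f)"
    using q by simp
  then have "(\<Sum>f\<in>T. 1 / real ?q ^ degree f) \<ge> 1 / 2" by simp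
  moreover have "T \<subseteq> monic_irreducibles" "T \<inter> T0 = {}" by (auto simp: T_def)
  ultimately show ?thesis using finT by blast
qed

text \<open>Repeats the half-mass step: every new batch avoids \<open>T0\<close> and the polynomials
  already used, so the masses add.\<close>

lemma irreducibles_mass_unbounded:
  fixes T0 :: "'a :: {field, finite} poly set"
  assumes "finite T0" "T0 \<subseteq> monic_irreducibles"
  shows "\<exists>T. finite T \<and> T \<subseteq> monic_irreducibles \<and> T \<inter> T0 = {} \<and>
    (\<Sum>f\<in>T. 1 / real CARD('a) ^ degree f) \<ge> real m / 2"
proof (induction m)
  case 0
  then show ?case by (intro exI[of _ "{}"]) auto
next
  case (Suc m)
  then obtain T where T: "finite T" "T \<subseteq> monic_irreducibles" "T \<inter> T0 = {}"
    "(\<Sum>f\<in>T. 1 / real CARD('a) ^ degree f) \<ge> real m / 2" by blast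
  obtain U where U: "finite U" "U \<subseteq> monic_irreducibles" "U \<inter> (T0 \<union> T) = {}"
    "(\<Sum>f\<in>U. 1 / real CARD('a) ^ degree f) \<ge> 1 / 2"
    using irreducibles_mass_half[of "T0 \<union> T"] T assms by auto
  have "(\<Sum>f\<in>T \<union> U. 1 / real CARD('a) ^ degree f) =
    (\<Sum>f\<in>T. 1 / real CARD('a) ^ degree f) + (\<Sum>f\<in>U. 1 / real CARD('a) ^ degree f)"
    using T U by (intro sum.union_disjoint) auto
  also have "\<dots> \<ge> real (Suc m) / 2" using T U by (simp add: field_simps)
  finally show ?case using T U by (intro exI[of _ "T \<union> U"]) auto
qed

text \<open>Each new family avoids \<open>T0\<close> and all earlier families. Disjointness ensures
  that choosing one polynomial from each family gives \<open>K\<close> distinct ones.\<close>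

lemma disjoint_irreducible_families:
  fixes T0 :: "'a :: {field, finite} poly set" and L :: real and K :: nat
  assumes "finite T0" "T0 \<subseteq> monic_irreducibles"
  shows "\<exists>T. (\<forall>i<K. finite (T i) \<and> T i \<subseteq> monic_irreducibles \<and> T i \<inter> T0 = {} \<and>
      (\<Sum>f\<in>T i. 1 / real CARD('a) ^ degree f) \<ge> L) \<and>
    (\<forall>i<K. \<forall>j<K. i \<noteq> j \<longrightarrow> T i \<inter> T j = {})"
proof (induction K)
  case 0
  then show ?case by simp
next
  case (Suc K)
  then obtain T where T: "\<And>i. i < K \<Longrightarrow> finite (T i) \<and> T i \<subseteq> monic_irreducibles \<and> T i \<inter> T0 = {} \<and>
      (\<Sum>f\<in>T i. 1 / real CARD('a) ^ degree f) \<ge> L"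
    "\<forall>i<K. \<forall>j<K. i \<noteq> j \<longrightarrow> T i \<inter> T j = {}" by blast
  obtain m :: nat where m: "2 * L \<le> real m" using real_arch_simple by blast
  obtain U where U: "finite U" "U \<subseteq> monic_irreducibles" "U \<inter> (T0 \<union> (\<Union>i<K. T i)) = {}"
    "(\<Sum>f\<in>U. 1 / real CARD('a) ^ degree f) \<ge> real m / 2"
  proof -
    have "finite (T0 \<union> (\<Union>i<K. T i))" "T0 \<union> (\<Union>i<K. T i) \<subseteq> monic_irreducibles"
      using T(1) assms by auto
    from irreducibles_mass_unbounded[OF this, of m] show ?thesis using that by blast
  qed
  show ?case
  proof (intro exI[of _ "T(K := U)"] conjI allI impI)
    fix i assume "i < Suc K"
    then show "finite ((T(K := U)) i)" "(T(K := U)) i \<subseteq> monic_irreducibles" "(T(K := U)) i \<inter> T0 = {}"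
      "(\<Sum>f\<in>(T(K := U)) i. 1 / real CARD('a) ^ degree f) \<ge> L"
      using T(1)[of i] U m by (cases "i = K"; auto)+
  next
    fix i j assume "i < Suc K" "j < Suc K" "i \<noteq> j"
    then show "(T(K := U)) i \<inter> (T(K := U)) j = {}"
      using T(2) U(3) by (cases "i = K"; cases "j = K") auto
  qed
qed

section \<open>Transitivity of the special linear group on injective matrices\<close>

lemma carrier_SL_iff: "A \<in> carrier (SL n) \<longleftrightarrow> A \<in> carrier_mat n n \<and> det A = 1"
  by (simp add: SL_def)

lemma mult_SL: "A \<otimes>\<^bsub>SL n\<^esub> B = A * B"
  by (simp add: SL_def)

lemma one_SL: "\<one>\<^bsub>SL n\<^esub> = 1\<^sub>m n"
  by (simp add: SL_def)

lemma finite_carrier_mat: "finite (carrier_mat n k :: 'a :: finite mat set)"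
proof -
  have "carrier_mat n k \<subseteq> mat n k ` (PiE ({..<n} \<times> {..<k}) (\<lambda>_. UNIV :: 'a set))"
  proof
    fix A :: "'a mat" assume "A \<in> carrier_mat n k"
    then have "A = mat n k (restrict (\<lambda>ij. A $$ ij) ({..<n} \<times> {..<k}))"
      by (intro eq_matI) auto
    moreover have "restrict (\<lambda>ij. A $$ ij) ({..<n} \<times> {..<k}) \<in> PiE ({..<n} \<times> {..<k}) (\<lambda>_. UNIV)"
      by auto
    ultimately show "A \<in> mat n k ` (PiE ({..<n} \<times> {..<k}) (\<lambda>_. UNIV))"
      by (metis image_eqI)
  qed
  then show ?thesis by (rule finite_subset) (intro finite_imageI finite_PiE, auto)
qed

lemma finite_carrier_SL: "finite (carrier (SL n :: 'a :: {field, finite} mat monoid))"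
  by (rule finite_subset[OF _ finite_carrier_mat[of n n]]) (auto simp: carrier_SL_iff)

lemma carrier_vec_card:
  "finite (carrier_vec n :: 'a :: finite vec set)"
  "card (carrier_vec n :: 'a :: finite vec set) = CARD('a) ^ n"
proof -
  have eq: "carrier_vec n = vec_of_list ` {xs :: 'a list. set xs \<subseteq> UNIV \<and> length xs = n}"
  proof (intro equalityI subsetI)
    fix v :: "'a vec" assume "v \<in> carrier_vec n"
    then have "v = vec_of_list (list_of_vec v)" "length (list_of_vec v) = n"
      by (auto simp: vec_list)
    then show "v \<in> vec_of_list ` {xs. set xs \<subseteq> UNIV \<and> length xs = n}" by blast
  next
    fix v :: "'a vec" assume "v \<in> vec_of_list ` {xs. set xs \<subseteq> UNIV \<and> length xs = n}"
    then obtain xs where "v = vec_of_list xs" "length xs = n" by blast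
    then show "v \<in> carrier_vec n" by (intro carrier_vecI) simp
  qed
  have inj: "inj_on vec_of_list {xs :: 'a list. set xs \<subseteq> UNIV \<and> length xs = n}"
    by (rule inj_onI) (metis list_vec)
  show "finite (carrier_vec n :: 'a vec set)"
    unfolding eq by (intro finite_imageI finite_lists_length_eq) simp
  show "card (carrier_vec n :: 'a vec set) = CARD('a) ^ n"
    unfolding eq card_image[OF inj] by (rule card_lists_length_eq) simp
qed

text \<open>The columns of a member are linearly independent: these are the \<open>k\<close>-frames
  of \<open>F ^ n\<close>, on which \<open>SL n\<close> acts by left multiplication.\<close>

definition inj_mats :: "nat \<Rightarrow> nat \<Rightarrow> 'a :: field mat set" where
  "inj_mats n k = {V \<in> carrier_mat n k. \<forall>x\<in>carrier_vec k. V *\<^sub>v x = 0\<^sub>v n \<longrightarrow> x = 0\<^sub>v k}"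

lemma inj_matsD:
  assumes "V \<in> inj_mats n k"
  shows "V \<in> carrier_mat n k" "x \<in> carrier_vec k \<Longrightarrow> V *\<^sub>v x = 0\<^sub>v n \<Longrightarrow> x = 0\<^sub>v k"
  using assms by (auto simp: inj_mats_def)

lemma finite_inj_mats: "finite (inj_mats n k :: 'a :: {field, finite} mat set)"
  by (rule finite_subset[OF _ finite_carrier_mat[of n k]]) (auto simp: inj_mats_def)

lemma mult_mat_zero_vec:
  "(A :: 'a :: field mat) \<in> carrier_mat n k \<Longrightarrow> A *\<^sub>v 0\<^sub>v k = 0\<^sub>v n"
  by (intro eq_vecI) auto

lemma inj_mats_mult:
  assumes "A \<in> inj_mats n k" "B \<in> inj_mats k l"
  shows "A * B \<in> inj_mats n l"
proof -
  have A: "A \<in> carrier_mat n k" and B: "B \<in> carrier_mat k l"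
    using assms by (auto dest: inj_matsD)
  have "x = 0\<^sub>v l" if "x \<in> carrier_vec l" "(A * B) *\<^sub>v x = 0\<^sub>v n" for x
  proof -
    have "A *\<^sub>v (B *\<^sub>v x) = 0\<^sub>v n" using that A B by simp
    moreover have "B *\<^sub>v x \<in> carrier_vec k" using B that by simp
    ultimately show ?thesis using assms that inj_matsD(2) by blast
  qed
  then show ?thesis using A B by (auto simp: inj_mats_def)
qed

lemma inj_mats_square_iff:
  "(A :: 'a :: field mat) \<in> inj_mats n n \<longleftrightarrow> A \<in> carrier_mat n n \<and> det A \<noteq> 0"
  using det_0_iff_vec_prod_zero_field[of A n] by (auto simp: inj_mats_def)

definition hcat :: "'a mat \<Rightarrow> 'a mat \<Rightarrow> 'a mat" where
  "hcat V W = mat (dim_row V) (dim_col V + dim_col W)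
    (\<lambda>(i, j). if j < dim_col V then V $$ (i, j) else W $$ (i, j - dim_col V))"

lemma hcat_carrier [simp]:
  "V \<in> carrier_mat n k \<Longrightarrow> W \<in> carrier_mat n l \<Longrightarrow> hcat V W \<in> carrier_mat n (k + l)"
  by (auto simp: hcat_def)

lemma hcat_mult_vec:
  fixes V W :: "'a :: comm_ring_1 mat"
  assumes V: "V \<in> carrier_mat n k" and W: "W \<in> carrier_mat n l"
    and x: "x \<in> carrier_vec k" and y: "y \<in> carrier_vec l"
  shows "hcat V W *\<^sub>v (x @\<^sub>v y) = V *\<^sub>v x + W *\<^sub>v y"
proof (rule eq_vecI)
  fix i assume "i < dim_vec (V *\<^sub>v x + W *\<^sub>v y)"
  then have i: "i < n" using W by simp
  have "row (hcat V W) i = row V i @\<^sub>v row W i"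
    using V W i by (intro eq_vecI) (auto simp: hcat_def)
  then have "(hcat V W *\<^sub>v (x @\<^sub>v y)) $ i = (row V i @\<^sub>v row W i) \<bullet> (x @\<^sub>v y)"
    using i hcat_carrier[OF V W] by (subst index_mult_mat_vec) auto
  also have "\<dots> = row V i \<bullet> x + row W i \<bullet> y"
    using V W x y i by (intro scalar_prod_append) auto
  finally show "(hcat V W *\<^sub>v (x @\<^sub>v y)) $ i = (V *\<^sub>v x + W *\<^sub>v y) $ i"
    using V W i by simp
qed (use V W in \<open>auto simp: hcat_def\<close>)

text \<open>Once \<open>disj\<close> gives \<open>x = 0\<close>, the vanishing sum reads
  \<open>W y = 0\<close>, and injectivity of \<open>W\<close> gives \<open>y = 0\<close>.\<close>

lemma hcat_inj_mats:
  assumes V: "V \<in> inj_mats n k" and W: "W \<in> inj_mats n l"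
    and disj: "\<And>x y. x \<in> carrier_vec k \<Longrightarrow> y \<in> carrier_vec l \<Longrightarrow> V *\<^sub>v x = W *\<^sub>v y \<Longrightarrow> x = 0\<^sub>v k"
  shows "hcat V W \<in> inj_mats n (k + l)"
proof -
  have Vc: "V \<in> carrier_mat n k" and Wc: "W \<in> carrier_mat n l"
    using V W by (auto dest: inj_matsD)
  have "z = 0\<^sub>v (k + l)" if z: "z \<in> carrier_vec (k + l)" "hcat V W *\<^sub>v z = 0\<^sub>v n" for z
  proof -
    define x y where "x = vec_first z k" and "y = vec_last z l"
    have xy: "x \<in> carrier_vec k" "y \<in> carrier_vec l" "z = x @\<^sub>v y"
      using z by (auto simp: x_def y_def)
    have sum0: "V *\<^sub>v x + W *\<^sub>v y = 0\<^sub>v n"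
      using hcat_mult_vec[OF Vc Wc xy(1,2)] z xy by simp
    have "V *\<^sub>v x = W *\<^sub>v (- y)"
    proof (rule eq_vecI)
      fix i assume "i < dim_vec (W *\<^sub>v (- y))"
      then have i: "i < n" using Wc by simp
      have "(V *\<^sub>v x + W *\<^sub>v y) $ i = 0" using sum0 i by simp
      then show "(V *\<^sub>v x) $ i = (W *\<^sub>v (- y)) $ i"
        using i Vc Wc xy by (simp add: eq_neg_iff_add_eq_0)
    qed (use Vc Wc in auto)
    then have x0: "x = 0\<^sub>v k" using disj[of x "- y"] xy by auto
    then have "W *\<^sub>v y = 0\<^sub>v n" using sum0 Wc xy by (simp add: mult_mat_zero_vec[OF Vc])
    then have "y = 0\<^sub>v l" using inj_matsD(2)[OF W] xy by blast
    with x0 xy show ?thesis by auto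
  qed
  then show ?thesis using Vc Wc by (auto simp: inj_mats_def)
qed

text \<open>By counting: the image of \<open>V\<close> has at most \<open>q ^ k < q ^ n\<close>
  vectors, so some \<open>v\<close> lies outside the column space and can serve as the new
  column.\<close>

lemma inj_mats_extend_column:
  fixes V :: "'a :: {field, finite} mat"
  assumes V: "V \<in> inj_mats n k" and k: "k < n"
  shows "\<exists>W\<in>carrier_mat n 1. hcat V W \<in> inj_mats n (Suc k)"
proof -
  have Vc: "V \<in> carrier_mat n k" using V by (rule inj_matsD)
  have "card {0 :: 'a, 1} \<le> CARD('a)" by (intro card_mono) auto
  then have q: "CARD('a) > 1" by simp
  have "card ((\<lambda>x. V *\<^sub>v x) ` carrier_vec k) \<le> card (carrier_vec k :: 'a vec set)"
    by (intro card_image_le carrier_vec_card)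
  also have "\<dots> < card (carrier_vec n :: 'a vec set)"
    using q k by (simp add: carrier_vec_card)
  finally have "\<not> carrier_vec n \<subseteq> (\<lambda>x. V *\<^sub>v x) ` carrier_vec k"
    using carrier_vec_card(1)[of k, where 'a = 'a] by (meson card_mono finite_imageI not_less)
  then obtain v where v: "v \<in> carrier_vec n" "\<And>x. x \<in> carrier_vec k \<Longrightarrow> v \<noteq> V *\<^sub>v x"
    by blast
  define W where "W = mat n 1 (\<lambda>(i, j). v $ i)"
  have W: "W \<in> carrier_mat n 1" by (simp add: W_def)
  have Wy: "W *\<^sub>v y = y $ 0 \<cdot>\<^sub>v v" if "y \<in> carrier_vec 1" for y
    using that v(1) by (intro eq_vecI) (auto simp: W_def scalar_prod_def)
  \<comment> \<open>If \<open>v\<close> occurred with a nonzero coefficient, dividing by it would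
    put \<open>v\<close> into the image of \<open>V\<close>.\<close>
  have y0: "y $ 0 = 0" if "x \<in> carrier_vec k" "y \<in> carrier_vec 1" "V *\<^sub>v x = W *\<^sub>v y" for x y
  proof (rule ccontr)
    assume ne: "y $ 0 \<noteq> 0"
    have "V *\<^sub>v (inverse (y $ 0) \<cdot>\<^sub>v x) = inverse (y $ 0) \<cdot>\<^sub>v (V *\<^sub>v x)"
      using Vc that by (intro mult_mat_vec) auto
    also have "\<dots> = v" using that Wy ne v(1) by (simp add: smult_smult_assoc)
    finally show False using v(2)[of "inverse (y $ 0) \<cdot>\<^sub>v x"] that by auto
  qed
  have "W \<in> inj_mats n 1"
  proof -
    have "y = 0\<^sub>v 1" if "y \<in> carrier_vec 1" "W *\<^sub>v y = 0\<^sub>v n" for y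
    proof -
      have "V *\<^sub>v 0\<^sub>v k = 0\<^sub>v n" by (rule mult_mat_zero_vec[OF Vc])
      then have "y $ 0 = 0" using y0[of "0\<^sub>v k" y] that by auto
      then show ?thesis using that by (intro eq_vecI) auto
    qed
    then show ?thesis using W by (auto simp: inj_mats_def)
  qed
  moreover have "x = 0\<^sub>v k" if "x \<in> carrier_vec k" "y \<in> carrier_vec 1" "V *\<^sub>v x = W *\<^sub>v y" for x y
  proof -
    have "W *\<^sub>v y = 0\<^sub>v n" using y0[OF that] Wy[OF that(2)] v(1) by auto
    with that show ?thesis using inj_matsD(2)[OF V] by auto
  qed
  ultimately have "hcat V W \<in> inj_mats n (k + 1)"
    using V by (intro hcat_inj_mats)
  with W show ?thesis by auto
qed

lemma inj_mats_complete:
  fixes V :: "'a :: {field, finite} mat"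
  assumes "V \<in> inj_mats n k" "k \<le> n"
  shows "\<exists>A\<in>inj_mats n n. \<forall>i<n. \<forall>j<k. A $$ (i, j) = V $$ (i, j)"
  using assms
proof (induction "n - k" arbitrary: k V)
  case 0
  then have "k = n" by simp
  with 0 show ?case by blast
next
  case (Suc m)
  then have "k < n" by simp
  then obtain W where W: "W \<in> carrier_mat n 1" "hcat V W \<in> inj_mats n (Suc k)"
    using inj_mats_extend_column[OF Suc.prems(1)] by blast
  have "m = n - Suc k" using Suc.hyps(2) by simp
  from Suc.hyps(1)[OF this W(2)] \<open>k < n\<close>
  obtain A where A: "A \<in> inj_mats n n" "\<forall>i<n. \<forall>j<Suc k. A $$ (i, j) = hcat V W $$ (i, j)"
    by auto
  have "V \<in> carrier_mat n k" using Suc.prems(1) by (rule inj_matsD)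
  then have "hcat V W $$ (i, j) = V $$ (i, j)" if "i < n" "j < k" for i j
    using that W(1) by (simp add: hcat_def)
  with A show ?case by (metis less_SucI)
qed

text \<open>As \<open>k < n\<close>, the last column of a completed basis does not belong to
  \<open>V\<close> and can be rescaled to make the determinant 1. All frames thus arise from one
  standard frame, which gives transitivity.\<close>

lemma inj_mats_complete_SL:
  fixes V :: "'a :: {field, finite} mat"
  assumes "V \<in> inj_mats n k" "k < n"
  shows "\<exists>P\<in>carrier (SL n). V = P * mat n k (\<lambda>(i, j). if i = j then 1 else 0)"
proof -
  obtain A where A: "A \<in> inj_mats n n" "\<forall>i<n. \<forall>j<k. A $$ (i, j) = V $$ (i, j)"
    using inj_mats_complete assms by (metis less_imp_le)
  then have Ac: "A \<in> carrier_mat n n" and d: "det A \<noteq> 0"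
    by (auto simp: inj_mats_square_iff)
  have V: "V \<in> carrier_mat n k" using assms(1) by (rule inj_matsD)
  \<comment> \<open>Column \<open>n - 1\<close> is scaled by \<open>1 / det A\<close>, written as a
    row operation on the transpose so that \<open>det_multrow\<close> applies.\<close>
  define P where "P = transpose_mat (multrow (n - 1) (1 / det A) (transpose_mat A))"
  have P: "P \<in> carrier_mat n n" using Ac by (simp add: P_def)
  have "det P = det (multrow (n - 1) (1 / det A) (transpose_mat A))"
    unfolding P_def using Ac by (intro det_transpose[of _ n]) simp
  also have "\<dots> = 1 / det A * det (transpose_mat A)"
    using Ac assms(2) by (intro det_multrow) auto
  also have "\<dots> = 1" using det_transpose[OF Ac] d by simp
  finally have "P \<in> carrier (SL n)" using P by (simp add: carrier_SL_iff)
  moreover have "V = P * mat n k (\<lambda>(i, j). if i = j then 1 else 0)" (is "_ = P * ?J")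
  proof (rule eq_matI)
    fix i j assume "i < dim_row (P * ?J)" "j < dim_col (P * ?J)"
    then have ij: "i < n" "j < k" using P by auto
    have "(P * ?J) $$ (i, j) = (\<Sum>m = 0..<n. P $$ (i, m) * (if m = j then 1 else 0))"
      using P ij by (simp add: scalar_prod_def)
    also have "\<dots> = (\<Sum>m = 0..<n. if m = j then P $$ (i, m) else 0)"
      by (rule sum.cong) auto
    also have "\<dots> = P $$ (i, j)" using ij assms(2) by simp
    also have "\<dots> = V $$ (i, j)" using ij assms(2) Ac A(2) by (simp add: P_def)
    finally show "V $$ (i, j) = (P * ?J) $$ (i, j)" by simp
  qed (use V P in auto)
  ultimately show ?thesis by blast
qed

lemma SL_inverse:
  assumes "A \<in> carrier (SL n)"
  shows "\<exists>B\<in>carrier (SL n). B * A = 1\<^sub>m n"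
  using group.l_inv_ex[OF group_SL assms] by (simp add: mult_SL one_SL)

lemma SL_mult: "A \<in> carrier (SL n) \<Longrightarrow> B \<in> carrier (SL n) \<Longrightarrow> A * B \<in> carrier (SL n)"
  using monoid.m_closed[OF group.is_monoid[OF group_SL], of A n B] by (simp add: mult_SL)

lemma SL_transitive:
  fixes V V' :: "'a :: {field, finite} mat"
  assumes "V \<in> inj_mats n k" "V' \<in> inj_mats n k" "k < n"
  shows "\<exists>A\<in>carrier (SL n). A * V = V'"
proof -
  let ?J = "mat n k (\<lambda>(i, j). if i = j then 1 else 0) :: 'a mat"
  obtain P P' where P: "P \<in> carrier (SL n)" "V = P * ?J" "P' \<in> carrier (SL n)" "V' = P' * ?J"
    using inj_mats_complete_SL[OF assms(1,3)] inj_mats_complete_SL[OF assms(2,3)] by blast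
  obtain Q where Q: "Q \<in> carrier (SL n)" "Q * P = 1\<^sub>m n" using SL_inverse[OF P(1)] by blast
  have c: "P \<in> carrier_mat n n" "P' \<in> carrier_mat n n" "Q \<in> carrier_mat n n"
    "?J \<in> carrier_mat n k"
    using P Q by (auto simp: carrier_SL_iff)
  have "(P' * Q) * V = P' * ((Q * P) * ?J)"
    using c P(2) by (simp add: assoc_mult_mat[of _ n n _ n _ k])
  also have "\<dots> = V'" using c P(4) Q(2) by simp
  finally show ?thesis using SL_mult[OF P(3) Q(1)] by blast
qed

section \<open>Orbit counting and intertwiners\<close>

lemma SL_inj_mats: "A \<in> carrier (SL n) \<Longrightarrow> A \<in> inj_mats n n"
  by (simp add: inj_mats_square_iff carrier_SL_iff)

text \<open>Left multiplication by an element carrying \<open>V'\<close> to \<open>V''\<close> maps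
  the first transporter injectively into the second. By symmetry all transporters from
  \<open>V\<close> have the same size.\<close>

lemma SL_transporter_card_le:
  fixes V :: "'a :: {field, finite} mat"
  assumes "V \<in> inj_mats n k" "V' \<in> inj_mats n k" "V'' \<in> inj_mats n k" "k < n"
  shows "card {B \<in> carrier (SL n). B * V = V'} \<le> card {B \<in> carrier (SL n). B * V = V''}"
proof -
  obtain A where A: "A \<in> carrier (SL n)" "A * V' = V''"
    using SL_transitive assms by blast
  have Vc: "V \<in> carrier_mat n k" using assms(1) by (rule inj_matsD)
  show ?thesis
  proof (rule card_inj_on_le)
    show "inj_on (\<lambda>B. A * B) {B \<in> carrier (SL n). B * V = V'}"
    proof (rule inj_onI)
      fix B B' assume B: "B \<in> {B \<in> carrier (SL n). B * V = V'}" "B' \<in> {B \<in> carrier (SL n). B * V = V'}"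
        "A * B = A * B'"
      interpret group "SL n :: 'a mat monoid" by (rule group_SL)
      show "B = B'" using B A(1) Units_l_cancel[of A B B'] by (simp add: mult_SL Units_eq)
    qed
    show "(\<lambda>B. A * B) ` {B \<in> carrier (SL n). B * V = V'} \<subseteq> {B \<in> carrier (SL n). B * V = V''}"
      using A Vc by (auto simp: SL_mult carrier_SL_iff det_mult assoc_mult_mat[of _ n n _ n _ k])
    show "finite {B \<in> carrier (SL n). B * V = V''}"
      by (rule finite_subset[OF _ finite_carrier_SL[of n]]) auto
  qed
qed

text \<open>Orbit-stabiliser: the transporters from \<open>V\<close> to the members of its orbit
  partition \<open>SL n\<close> into parts of equal size, and by transitivity the orbit is all of
  \<open>inj_mats n k\<close>.\<close>

lemma SL_transporter_card:
  fixes V :: "'a :: {field, finite} mat"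
  assumes "V \<in> inj_mats n k" "V' \<in> inj_mats n k" "k < n"
  shows "card (inj_mats n k :: 'a mat set) * card {B \<in> carrier (SL n). B * V = V'} =
    card (carrier (SL n :: 'a mat monoid))"
proof -
  let ?O = "inj_mats n k :: 'a mat set" and ?G = "carrier (SL n :: 'a mat monoid)"
  have "card ?G = (\<Sum>U\<in>?O. card {B \<in> ?G. B * V = U})"
  proof -
    have "?G = (\<Union>U\<in>?O. {B \<in> ?G. B * V = U})"
      using inj_mats_mult[OF SL_inj_mats assms(1)] by blast
    then have "card ?G = card (\<Union>U\<in>?O. {B \<in> ?G. B * V = U})" by simp
    also have "\<dots> = (\<Sum>U\<in>?O. card {B \<in> ?G. B * V = U})"
      by (intro card_UN_disjoint finite_inj_mats ballI finite_subset[OF _ finite_carrier_SL[of n]]) auto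
    finally show ?thesis .
  qed
  also have "\<dots> = (\<Sum>U\<in>?O. card {B \<in> ?G. B * V = V'})"
    using SL_transporter_card_le assms by (intro sum.cong refl antisym) blast+
  finally show ?thesis by simp
qed

text \<open>With \<open>x\<close> acting through \<open>C\<close> and \<open>B\<close>, the members
  are the injective \<open>F[x]\<close>-module homomorphisms from \<open>F ^ k\<close> to
  \<open>F ^ n\<close>.\<close>

definition intertwiners :: "nat \<Rightarrow> nat \<Rightarrow> 'a :: field mat \<Rightarrow> 'a mat \<Rightarrow> 'a mat set" where
  "intertwiners n k B C = {V \<in> inj_mats n k. B * V = V * C}"

lemma finite_intertwiners: "finite (intertwiners n k (B :: 'a :: {field, finite} mat) C)"
  by (rule finite_subset[OF _ finite_inj_mats[of n k]]) (auto simp: intertwiners_def)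

text \<open>For every \<open>V\<close> the matrices \<open>B\<close> with \<open>B * V = V * C\<close> form a coset of a point stabiliser.\<close>

lemma sum_card_intertwiners:
  fixes C :: "'a :: {field, finite} mat"
  assumes "C \<in> inj_mats k k" "k < n"
  shows "(\<Sum>B\<in>carrier (SL n). card (intertwiners n k B C)) = card (carrier (SL n :: 'a mat monoid))"
proof -
  let ?O = "inj_mats n k :: 'a mat set" and ?G = "carrier (SL n :: 'a mat monoid)"
  \<comment> \<open>Pairs \<open>(B, V)\<close> with \<open>B * V = V * C\<close> are counted by
    \<open>V\<close> instead. Invertibility of \<open>C\<close> makes \<open>V * C\<close>
    injective, so each \<open>V\<close> has the same number of partners \<open>B\<close>.\<close>
  have "(\<Sum>B\<in>?G. card (intertwiners n k B C)) = (\<Sum>V\<in>?O. card {B \<in> ?G. B * V = V * C})"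
    unfolding intertwiners_def
    using finite_inj_mats finite_carrier_SL by (intro sum_multicount_gen) auto
  moreover have "card ?O * (\<Sum>V\<in>?O. card {B \<in> ?G. B * V = V * C}) = card ?O * card ?G"
    using assms by (simp add: sum_distrib_left SL_transporter_card inj_mats_mult)
  \<comment> \<open>The standard frame shows that the orbit is nonempty, so its size can be
    cancelled.\<close>
  moreover have "card ?O \<noteq> 0"
  proof -
    have "x = 0\<^sub>v k" if "x \<in> carrier_vec k"
      "mat n k (\<lambda>(i, j). if i = j then 1 else 0) *\<^sub>v x = 0\<^sub>v n" for x :: "'a vec"
    proof (rule eq_vecI)
      fix i assume "i < dim_vec (0\<^sub>v k :: 'a vec)"
      then have i: "i < k" by simp
      have "(mat n k (\<lambda>(i, j). if i = j then 1 else 0) *\<^sub>v x) $ i =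
        (\<Sum>m = 0..<k. (if i = m then 1 else 0) * x $ m)"
        using that(1) i assms(2) by (simp add: scalar_prod_def)
      also have "\<dots> = (\<Sum>m = 0..<k. if i = m then x $ m else 0)"
        by (rule sum.cong) auto
      also have "\<dots> = x $ i" using i by simp
      finally show "x $ i = 0\<^sub>v k $ i" using that(2) i assms(2) by simp
    qed (use that in auto)
    then have "mat n k (\<lambda>(i, j). if i = j then 1 else 0) \<in> ?O" by (simp add: inj_mats_def)
    then show ?thesis using finite_inj_mats by (metis card_eq_0_iff empty_iff)
  qed
  ultimately show ?thesis by simp
qed

section \<open>Polynomials in a matrix and companion matrices\<close>

lemma eq_mat_by_vec:
  fixes V W :: "'a :: field mat"
  assumes V: "V \<in> carrier_mat n k" and W: "W \<in> carrier_mat n k"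
    and eq: "\<And>x. x \<in> carrier_vec k \<Longrightarrow> V *\<^sub>v x = W *\<^sub>v x"
  shows "V = W"
proof (rule mat_col_eqI)
  fix j assume "j < dim_col W"
  then have j: "j < k" using W by simp
  have "V *\<^sub>v unit_vec k j = W *\<^sub>v unit_vec k j" by (rule eq) simp
  then show "col V j = col W j"
    using col_mult2[OF V one_carrier_mat j] col_mult2[OF W one_carrier_mat j] V W j by simp
qed (use V W in auto)

text \<open>Horner's scheme for \<open>p(B)\<close>; the argument \<open>n\<close> fixes the
  dimension of the initial zero matrix.\<close>

definition mat_poly :: "nat \<Rightarrow> 'a :: field mat \<Rightarrow> 'a poly \<Rightarrow> 'a mat" where
  "mat_poly n B p = fold_coeffs (\<lambda>a A. a \<cdot>\<^sub>m 1\<^sub>m n + B * A) p (0\<^sub>m n n)"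

context
  fixes n :: nat and B :: "'a :: field mat"
  assumes B: "B \<in> carrier_mat n n"
begin

lemma mat_poly_0: "mat_poly n B 0 = 0\<^sub>m n n"
  by (simp add: mat_poly_def)

lemma mat_poly_pCons: "mat_poly n B (pCons a p) = a \<cdot>\<^sub>m 1\<^sub>m n + B * mat_poly n B p"
proof (cases "a = 0 \<and> p = 0")
  case True
  have "0 \<cdot>\<^sub>m 1\<^sub>m n + B * 0\<^sub>m n n = 0\<^sub>m n n" using B by (intro eq_matI) auto
  then show ?thesis using True by (simp add: mat_poly_0)
next
  case False
  then show ?thesis
    by (cases "a = 0") (auto simp: mat_poly_def fold_coeffs_pCons_coeff_not_0_eq fold_coeffs_pCons_not_0_0_eq)
qed

lemma mat_poly_carrier [simp]: "mat_poly n B p \<in> carrier_mat n n"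
  by (induction p) (use B in \<open>auto simp: mat_poly_0 mat_poly_pCons\<close>)

lemma mat_poly_dim [simp]: "dim_row (mat_poly n B p) = n" "dim_col (mat_poly n B p) = n"
  using carrier_matD[OF mat_poly_carrier] by auto

lemma mat_poly_add: "mat_poly n B (p + r) = mat_poly n B p + mat_poly n B r"
proof (induction p r rule: poly_induct2)
  case (pCons a p b r)
  have "B * (mat_poly n B p + mat_poly n B r) = B * mat_poly n B p + B * mat_poly n B r"
    using B by (intro mult_add_distrib_mat[of _ n n _ n]) auto
  then show ?case
    using B mat_poly_carrier[of p] mat_poly_carrier[of r]
    by (simp add: mat_poly_pCons pCons) (intro eq_matI, auto simp: algebra_simps)
qed (simp add: mat_poly_0)

lemma mat_poly_smult: "mat_poly n B (Polynomial.smult c p) = c \<cdot>\<^sub>m mat_poly n B p"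
proof (induction p)
  case (pCons a p)
  have "B * (c \<cdot>\<^sub>m mat_poly n B p) = c \<cdot>\<^sub>m (B * mat_poly n B p)"
    using B by (intro mult_smult_distrib[of _ n n _ n]) auto
  then show ?case
    using B mat_poly_carrier[of p]
    by (simp add: mat_poly_pCons pCons) (intro eq_matI, auto simp: algebra_simps)
qed (auto simp: mat_poly_0)

lemma mat_poly_mult: "mat_poly n B (p * r) = mat_poly n B p * mat_poly n B r"
proof (induction p)
  case (pCons a p)
  let ?P = "mat_poly n B p" and ?R = "mat_poly n B r"
  have "mat_poly n B (pCons a p * r) = a \<cdot>\<^sub>m ?R + (0 \<cdot>\<^sub>m 1\<^sub>m n + B * (?P * ?R))"
    by (simp add: mat_poly_add mat_poly_smult mat_poly_pCons pCons)
  also have "0 \<cdot>\<^sub>m 1\<^sub>m n + B * (?P * ?R) = B * (?P * ?R)"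
    using B by (intro eq_matI) auto
  also have "a \<cdot>\<^sub>m ?R + B * (?P * ?R) = (a \<cdot>\<^sub>m 1\<^sub>m n) * ?R + B * ?P * ?R"
    using B mat_poly_carrier[of p] mat_poly_carrier[of r]
    by (simp add: mult_smult_assoc_mat[of _ n n _ n] assoc_mult_mat[of _ n n _ n _ n])
  also have "\<dots> = (a \<cdot>\<^sub>m 1\<^sub>m n + B * ?P) * ?R"
    using B by (intro add_mult_distrib_mat[symmetric, of _ n n _ _ n]) auto
  finally show ?case by (simp add: mat_poly_pCons)
qed (use left_mult_zero_mat[OF mat_poly_carrier] in \<open>auto simp: mat_poly_0\<close>)

lemma mat_poly_1: "mat_poly n B 1 = 1\<^sub>m n"
  using B by (simp add: one_pCons mat_poly_pCons mat_poly_0) (intro eq_matI, auto)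

lemma mat_poly_X: "mat_poly n B [:0, 1:] = B"
  using B by (simp add: mat_poly_pCons mat_poly_0) (intro eq_matI, auto)

lemma mat_poly_power: "mat_poly n B (p ^ j) = mat_poly n B p ^\<^sub>m j"
proof (induction j)
  case (Suc j)
  have "p ^ Suc j = p ^ j * p" by simp
  then show ?case by (simp only: mat_poly_mult Suc pow_mat.simps)
qed (use carrier_matD[OF mat_poly_carrier] in \<open>simp add: mat_poly_1\<close>)

lemma mat_poly_mult_vec:
  "v \<in> carrier_vec n \<Longrightarrow> mat_poly n B (p * r) *\<^sub>v v = mat_poly n B p *\<^sub>v (mat_poly n B r *\<^sub>v v)"
  unfolding mat_poly_mult by (rule assoc_mult_mat_vec[of _ n n _ n]) auto

lemma mat_poly_mult_vec_closed [simp]: "v \<in> carrier_vec n \<Longrightarrow> mat_poly n B p *\<^sub>v v \<in> carrier_vec n"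
  by (rule mult_mat_vec_carrier) auto

lemma mat_poly_add_vec:
  "v \<in> carrier_vec n \<Longrightarrow>
    mat_poly n B (p + r) *\<^sub>v v = mat_poly n B p *\<^sub>v v + mat_poly n B r *\<^sub>v v"
  unfolding mat_poly_add by (rule add_mult_distrib_mat_vec[of _ n n]) auto

lemma mat_poly_pCons_vec:
  assumes v: "v \<in> carrier_vec n"
  shows "mat_poly n B (pCons a p) *\<^sub>v v = a \<cdot>\<^sub>v v + B *\<^sub>v (mat_poly n B p *\<^sub>v v)"
proof -
  have "mat_poly n B (pCons a p) *\<^sub>v v = (a \<cdot>\<^sub>m 1\<^sub>m n) *\<^sub>v v + (B * mat_poly n B p) *\<^sub>v v"
    unfolding mat_poly_pCons using B v by (intro add_mult_distrib_mat_vec[of _ n n]) auto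
  also have "(a \<cdot>\<^sub>m 1\<^sub>m n) *\<^sub>v v = a \<cdot>\<^sub>v v"
    using v by (intro eq_vecI) (auto simp: row_smult)
  also have "(B * mat_poly n B p) *\<^sub>v v = B *\<^sub>v (mat_poly n B p *\<^sub>v v)"
    using B v by (intro assoc_mult_mat_vec[of _ n n _ n]) auto
  finally show ?thesis .
qed

lemma mat_poly_zero_vec [simp]: "mat_poly n B p *\<^sub>v 0\<^sub>v n = 0\<^sub>v n"
  by (rule mult_mat_zero_vec) auto

lemma mat_poly_1_vec: "v \<in> carrier_vec n \<Longrightarrow> mat_poly n B 1 *\<^sub>v v = v"
  by (simp add: mat_poly_1)

lemma mat_poly_coprime_vec:
  assumes v: "v \<in> carrier_vec n" and "coprime a b"
    and a: "mat_poly n B a *\<^sub>v v = 0\<^sub>v n" and b: "mat_poly n B b *\<^sub>v v = 0\<^sub>v n"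
  shows "v = 0\<^sub>v n"
proof -
  obtain u w where "u * a + w * b = 1" using bezout_poly[OF assms(2)] by blast
  then have "v = mat_poly n B (u * a + w * b) *\<^sub>v v" using v by (simp add: mat_poly_1_vec)
  also have "\<dots> = 0\<^sub>v n" using v a b by (simp add: mat_poly_add_vec mat_poly_mult_vec)
  finally show ?thesis .
qed

end

section \<open>Homomorphisms of \<open>F[x]\<close>-modules and the cyclic module
  \<open>F[x]/(f)\<close>\<close>

lemma mat_poly_intertwine:
  assumes B: "B \<in> carrier_mat n n" and V: "V \<in> carrier_mat n k" and C: "C \<in> carrier_mat k k"
    and eq: "B * V = V * C" and x: "x \<in> carrier_vec k"
  shows "mat_poly n B p *\<^sub>v (V *\<^sub>v x) = V *\<^sub>v (mat_poly k C p *\<^sub>v x)"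
proof (induction p)
  case 0
  have "0\<^sub>m n n *\<^sub>v (V *\<^sub>v x) = 0\<^sub>v n" "0\<^sub>m k k *\<^sub>v x = 0\<^sub>v k"
    using V x by (auto intro!: eq_vecI)
  then show ?case by (simp add: mat_poly_0[OF B] mat_poly_0[OF C] mult_mat_zero_vec[OF V])
next
  case (pCons a p)
  define y where "y = mat_poly k C p *\<^sub>v x"
  have y: "y \<in> carrier_vec k" using C x by (simp add: y_def)
  have Vx: "V *\<^sub>v x \<in> carrier_vec n" using V x by simp
  have "B *\<^sub>v (V *\<^sub>v y) = (B * V) *\<^sub>v y" using B V y by simp
  also have "\<dots> = V *\<^sub>v (C *\<^sub>v y)" using V C y by (simp add: eq)
  finally have By: "B *\<^sub>v (V *\<^sub>v y) = V *\<^sub>v (C *\<^sub>v y)" .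
  have "V *\<^sub>v (a \<cdot>\<^sub>v x + C *\<^sub>v y) = V *\<^sub>v (a \<cdot>\<^sub>v x) + V *\<^sub>v (C *\<^sub>v y)"
    using V C x y by (intro mult_add_distrib_mat_vec) auto
  also have "V *\<^sub>v (a \<cdot>\<^sub>v x) = a \<cdot>\<^sub>v (V *\<^sub>v x)" using V x by (rule mult_mat_vec)
  finally show ?case
    using By pCons by (simp add: mat_poly_pCons_vec[OF B Vx] mat_poly_pCons_vec[OF C x] y_def[symmetric])
qed

text \<open>Coordinates of the class of \<open>p\<close> in \<open>F[x]/(f)\<close> with respect to
  the basis \<open>1, x, x ^ 2, ...\<close>.\<close>

definition poly_vec :: "'a :: field poly \<Rightarrow> 'a poly \<Rightarrow> 'a vec" where
  "poly_vec f p = vec (degree f) (coeff (p mod f))"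

text \<open>Multiplication by \<open>x\<close> on \<open>F[x]/(f)\<close> in the same basis: column
  \<open>j\<close> holds \<open>x ^ (j + 1)\<close> reduced modulo \<open>f\<close>, so only the
  last column differs from a shift.\<close>

definition companion :: "'a :: field poly \<Rightarrow> 'a mat" where
  "companion f = mat (degree f) (degree f) (\<lambda>(i, j). coeff (monom 1 (Suc j) mod f) i)"

lemma companion_carrier [simp]: "companion f \<in> carrier_mat (degree f) (degree f)"
  by (simp add: companion_def)

lemma poly_vec_carrier [simp]: "poly_vec f p \<in> carrier_vec (degree f)"
  by (simp add: poly_vec_def)

lemma poly_vec_add: "poly_vec f (p + r) = poly_vec f p + poly_vec f r"
  by (intro eq_vecI) (auto simp: poly_vec_def poly_mod_add_left)

lemma poly_vec_smult: "poly_vec f (Polynomial.smult c p) = c \<cdot>\<^sub>v poly_vec f p"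
  by (intro eq_vecI) (auto simp: poly_vec_def mod_smult_left)

lemma mod_sum_poly: "(\<Sum>i\<in>A. g i) mod f = (\<Sum>i\<in>A. g i mod f)" for f :: "'a :: field poly"
  by (induction A rule: infinite_finite_induct) (auto simp: poly_mod_add_left)

context
  fixes f :: "'a :: field poly"
  assumes f: "degree f > 0"
begin

lemma poly_vec_eq_0_iff: "poly_vec f p = 0\<^sub>v (degree f) \<longleftrightarrow> f dvd p"
proof
  assume eq: "poly_vec f p = 0\<^sub>v (degree f)"
  have small: "coeff (p mod f) i = 0" if "i < degree f" for i
  proof -
    have "poly_vec f p $ i = 0" using that eq by simp
    then show ?thesis using that by (simp add: poly_vec_def)
  qed
  have "f \<noteq> 0" using f by auto
  from degree_mod_less[OF this, of p] have "coeff (p mod f) i = 0" if "i \<ge> degree f" for i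
    using that by (auto intro: coeff_eq_0)
  with small have "p mod f = 0" by (intro poly_eqI) (metis coeff_0 not_le)
  then show "f dvd p" by (simp add: mod_eq_0_iff_dvd)
next
  assume "f dvd p"
  then show "poly_vec f p = 0\<^sub>v (degree f)" by (intro eq_vecI) (auto simp: poly_vec_def)
qed

lemma poly_vec_surj:
  assumes "x \<in> carrier_vec (degree f)"
  shows "\<exists>p. x = poly_vec f p"
proof -
  define p where "p = Poly (list_of_vec x)"
  have len: "length (list_of_vec x) = degree f" using assms by simp
  have "degree p < degree f"
  proof (cases "p = 0")
    case False
    then have "nth_default 0 (list_of_vec x) (degree p) \<noteq> 0"
      using leading_coeff_neq_0[of p] by (simp add: p_def coeff_Poly_eq)
    then show ?thesis using len by (auto simp: nth_default_def split: if_splits)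
  qed (use f in simp)
  then have "p mod f = p" by (rule mod_poly_less)
  then have "x = poly_vec f p"
    using assms by (intro eq_vecI) (auto simp: poly_vec_def p_def coeff_Poly_eq nth_default_def list_of_vec_index)
  then show ?thesis by blast
qed

text \<open>\<open>pCons 0 p\<close> is \<open>x * p\<close>. The remainder of \<open>p\<close> is
  expanded into monomials, and reduction modulo \<open>f\<close> is linear, which yields the
  combination of the columns of \<open>companion f\<close>.\<close>

lemma companion_poly_vec: "companion f *\<^sub>v poly_vec f p = poly_vec f (pCons 0 p)"
proof -
  define r where "r = p mod f"
  have "f \<noteq> 0" using f by auto
  from degree_mod_less[OF this, of p] have deg: "degree r \<le> degree f - 1"
    using f by (auto simp: r_def)
  have "(\<Sum>j\<le>degree f - 1. monom (coeff r j) j) = r" by (rule poly_as_sum_of_monoms'[OF deg])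
  moreover have "{..degree f - 1} = {0..<degree f}" using f by auto
  ultimately have r: "r = (\<Sum>j = 0..<degree f. monom (coeff r j) j)" by simp
  have "pCons 0 p mod f = [:0, 1:] * p mod f" by simp
  also have "\<dots> = [:0, 1:] * r mod f" unfolding r_def by (simp only: mod_mult_right_eq)
  also have "[:0, 1:] * r = (\<Sum>j = 0..<degree f. monom (coeff r j) (Suc j))"
    by (subst r) (simp add: sum_distrib_left monom_Suc)
  also have "\<dots> mod f = (\<Sum>j = 0..<degree f. Polynomial.smult (coeff r j) (monom 1 (Suc j) mod f))"
    unfolding mod_sum_poly by (intro sum.cong refl) (simp add: mod_smult_left[symmetric] smult_monom)
  finally have eq: "pCons 0 p mod f = \<dots>" .
  show ?thesis
  proof (rule eq_vecI)
    fix i assume "i < dim_vec (poly_vec f (pCons 0 p))"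
    then have i: "i < degree f" by (simp add: poly_vec_def)
    then show "(companion f *\<^sub>v poly_vec f p) $ i = poly_vec f (pCons 0 p) $ i"
      by (simp add: companion_def poly_vec_def scalar_prod_def eq coeff_sum r_def mult.commute)
  qed (simp add: poly_vec_def companion_def)
qed

lemma mat_poly_companion:
  "mat_poly (degree f) (companion f) p *\<^sub>v poly_vec f r = poly_vec f (p * r)"
proof (induction p)
  case 0
  then show ?case by (intro eq_vecI) (auto simp: mat_poly_0[OF companion_carrier] poly_vec_def)
next
  case (pCons a p)
  then show ?case
    by (simp add: mat_poly_pCons_vec[OF companion_carrier] companion_poly_vec poly_vec_add poly_vec_smult)
qed

text \<open>Multiplication by \<open>x\<close> on \<open>F[x]/(f)\<close> is injective when
  \<open>x\<close> is invertible modulo \<open>f\<close>. Among the monic irreducibles this excludes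
  just \<open>x\<close> itself.\<close>

lemma companion_inj_mats:
  assumes "coprime f [:0, 1:]"
  shows "companion f \<in> inj_mats (degree f) (degree f)"
proof -
  have "x = 0\<^sub>v (degree f)" if x: "x \<in> carrier_vec (degree f)" "companion f *\<^sub>v x = 0\<^sub>v (degree f)" for x
  proof -
    obtain p where p: "x = poly_vec f p" using poly_vec_surj[OF x(1)] by blast
    with x(2) have "f dvd [:0, 1:] * p"
      by (simp add: companion_poly_vec poly_vec_eq_0_iff)
    then have "f dvd p" using assms by (rule coprime_dvd_mult_poly[rotated])
    then show ?thesis by (simp add: p poly_vec_eq_0_iff)
  qed
  then show ?thesis by (simp add: inj_mats_def)
qed

context
  fixes n :: nat and B V :: "'a mat"
  assumes B: "B \<in> carrier_mat n n" and V: "V \<in> intertwiners n (degree f) B (companion f)"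
begin

lemma intertwiner_inj: "V \<in> inj_mats n (degree f)" and intertwiner_carrier: "V \<in> carrier_mat n (degree f)"
  using V by (auto simp: intertwiners_def inj_mats_def)

text \<open>\<open>F[x]/(f)\<close> is generated by the class of 1, so an embedding is determined by
  the image of that generator.\<close>

lemma intertwiner_poly_vec:
  "V *\<^sub>v poly_vec f p = mat_poly n B p *\<^sub>v (V *\<^sub>v poly_vec f 1)"
  using mat_poly_intertwine[OF B intertwiner_carrier companion_carrier _ poly_vec_carrier, of p 1] V
  by (simp add: intertwiners_def mat_poly_companion)

lemma intertwiner_generator_carrier: "V *\<^sub>v poly_vec f 1 \<in> carrier_vec n"
  using intertwiner_carrier by simp

text \<open>Injectivity of \<open>V\<close> carries the annihilator \<open>(f)\<close> of the class
  of 1 over to its image.\<close>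

lemma mat_poly_intertwiner_eq_0_iff:
  "mat_poly n B p *\<^sub>v (V *\<^sub>v poly_vec f 1) = 0\<^sub>v n \<longleftrightarrow> f dvd p"
proof -
  have "V *\<^sub>v poly_vec f p = 0\<^sub>v n \<longleftrightarrow> poly_vec f p = 0\<^sub>v (degree f)"
  proof
    assume "V *\<^sub>v poly_vec f p = 0\<^sub>v n"
    then show "poly_vec f p = 0\<^sub>v (degree f)" by (rule inj_matsD(2)[OF intertwiner_inj poly_vec_carrier])
  next
    assume "poly_vec f p = 0\<^sub>v (degree f)"
    then show "V *\<^sub>v poly_vec f p = 0\<^sub>v n" by (simp only: mult_mat_zero_vec[OF intertwiner_carrier])
  qed
  then show ?thesis by (simp only: intertwiner_poly_vec[of p] poly_vec_eq_0_iff)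
qed

end

lemma intertwiner_generator_inj:
  assumes "B \<in> carrier_mat n n"
  shows "inj_on (\<lambda>V. V *\<^sub>v poly_vec f 1) (intertwiners n (degree f) B (companion f))"
proof (rule inj_onI)
  fix V W
  assume VW: "V \<in> intertwiners n (degree f) B (companion f)" "W \<in> intertwiners n (degree f) B (companion f)"
    and eq: "V *\<^sub>v poly_vec f 1 = W *\<^sub>v poly_vec f 1"
  show "V = W"
  proof (rule eq_mat_by_vec)
    fix x :: "'a vec" assume "x \<in> carrier_vec (degree f)"
    then obtain p where x: "x = poly_vec f p" using poly_vec_surj by blast
    show "V *\<^sub>v x = W *\<^sub>v x"
      unfolding x intertwiner_poly_vec[OF assms VW(1), of p] intertwiner_poly_vec[OF assms VW(2), of p] eq
      by (rule refl)
  qed (use VW intertwiner_carrier[OF assms] in auto)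
qed

end

section \<open>Second moments\<close>

abbreviation block_diag :: "nat \<Rightarrow> nat \<Rightarrow> 'a :: field mat \<Rightarrow> 'a mat \<Rightarrow> 'a mat" where
  "block_diag k l C D \<equiv> four_block_mat C (0\<^sub>m k l) (0\<^sub>m l k) D"

lemma block_diag_mult_vec:
  assumes C: "C \<in> carrier_mat k k" and D: "D \<in> carrier_mat l l"
    and x: "x \<in> carrier_vec k" and y: "y \<in> carrier_vec l"
  shows "block_diag k l C D *\<^sub>v (x @\<^sub>v y) = (C *\<^sub>v x) @\<^sub>v (D *\<^sub>v y)"
proof -
  have z: "0\<^sub>m k l *\<^sub>v y = 0\<^sub>v k" "0\<^sub>m l k *\<^sub>v x = 0\<^sub>v l" using x y by (auto intro!: eq_vecI)
  have "block_diag k l C D *\<^sub>v (x @\<^sub>v y) =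
    (C *\<^sub>v x + 0\<^sub>m k l *\<^sub>v y) @\<^sub>v (0\<^sub>m l k *\<^sub>v x + D *\<^sub>v y)"
    using assms by (intro four_block_mat_mult_vec) auto
  also have "\<dots> = (C *\<^sub>v x) @\<^sub>v (D *\<^sub>v y)"
    using assms by (simp add: z)
  finally show ?thesis .
qed

lemma vec_split_append:
  assumes "z \<in> carrier_vec (k + l)"
  obtains x y where "x \<in> carrier_vec k" "y \<in> carrier_vec l" "z = x @\<^sub>v y"
  using that[of "vec_first z k" "vec_last z l"] assms by simp

lemma zero_vec_append: "0\<^sub>v (k + l) = 0\<^sub>v k @\<^sub>v 0\<^sub>v l"
  by (intro eq_vecI) auto

lemma block_diag_inj_mats:
  assumes C: "C \<in> inj_mats k k" and D: "D \<in> inj_mats l l"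
  shows "block_diag k l C D \<in> inj_mats (k + l) (k + l)"
proof -
  have c: "C \<in> carrier_mat k k" "D \<in> carrier_mat l l" using C D by (auto dest: inj_matsD)
  have "z = 0\<^sub>v (k + l)" if z: "z \<in> carrier_vec (k + l)" "block_diag k l C D *\<^sub>v z = 0\<^sub>v (k + l)" for z
  proof -
    obtain x y where xy: "x \<in> carrier_vec k" "y \<in> carrier_vec l" "z = x @\<^sub>v y"
      using vec_split_append[OF z(1)] .
    have "(C *\<^sub>v x) @\<^sub>v (D *\<^sub>v y) = 0\<^sub>v k @\<^sub>v 0\<^sub>v l"
      using z(2) block_diag_mult_vec[OF c xy(1,2)] xy(3) by (simp add: zero_vec_append)
    moreover have "C *\<^sub>v x \<in> carrier_vec k" using c xy by simp
    ultimately have "C *\<^sub>v x = 0\<^sub>v k" "D *\<^sub>v y = 0\<^sub>v l"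
      using append_vec_eq[of "C *\<^sub>v x" k "0\<^sub>v k"] by auto
    then show ?thesis using inj_matsD(2)[OF C xy(1)] inj_matsD(2)[OF D xy(2)] xy(3)
      by (simp add: zero_vec_append)
  qed
  then show ?thesis using c by (simp add: inj_mats_def)
qed

text \<open>Two embeddings with independent images combine into one embedding of the direct sum,
  whose \<open>x\<close>-action is block diagonal.\<close>

lemma hcat_intertwiner:
  assumes B: "B \<in> carrier_mat n n" and C: "C \<in> carrier_mat k k" and D: "D \<in> carrier_mat l l"
    and V: "V \<in> intertwiners n k B C" and W: "W \<in> intertwiners n l B D"
    and inj: "hcat V W \<in> inj_mats n (k + l)"
  shows "hcat V W \<in> intertwiners n (k + l) B (block_diag k l C D)"
proof -
  have Vc: "V \<in> carrier_mat n k" and Wc: "W \<in> carrier_mat n l"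
    and eq: "B * V = V * C" "B * W = W * D"
    using V W by (auto simp: intertwiners_def inj_mats_def)
  have "B * hcat V W = hcat V W * block_diag k l C D"
  proof (rule eq_mat_by_vec)
    show "B * hcat V W \<in> carrier_mat n (k + l)" using B Vc Wc by simp
    show "hcat V W * block_diag k l C D \<in> carrier_mat n (k + l)"
      by (rule mult_carrier_mat[OF hcat_carrier[OF Vc Wc] four_block_carrier_mat[OF C D]])
    fix z :: "'a vec" assume z: "z \<in> carrier_vec (k + l)"
    obtain x y where xy: "x \<in> carrier_vec k" "y \<in> carrier_vec l" "z = x @\<^sub>v y"
      using vec_split_append[OF z] .
    have "(B * hcat V W) *\<^sub>v z = B *\<^sub>v (V *\<^sub>v x + W *\<^sub>v y)"
      using assoc_mult_mat_vec[OF B hcat_carrier[OF Vc Wc] z] hcat_mult_vec[OF Vc Wc xy(1,2)] xy(3)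
      by simp
    also have "\<dots> = B *\<^sub>v (V *\<^sub>v x) + B *\<^sub>v (W *\<^sub>v y)"
      using B Vc Wc xy by (intro mult_add_distrib_mat_vec[of _ n n]) auto
    also have "B *\<^sub>v (V *\<^sub>v x) = V *\<^sub>v (C *\<^sub>v x)"
      using assoc_mult_mat_vec[OF B Vc xy(1)] assoc_mult_mat_vec[OF Vc C xy(1)] eq by simp
    also have "B *\<^sub>v (W *\<^sub>v y) = W *\<^sub>v (D *\<^sub>v y)"
      using assoc_mult_mat_vec[OF B Wc xy(2)] assoc_mult_mat_vec[OF Wc D xy(2)] eq by simp
    also have "V *\<^sub>v (C *\<^sub>v x) + W *\<^sub>v (D *\<^sub>v y) = hcat V W *\<^sub>v ((C *\<^sub>v x) @\<^sub>v (D *\<^sub>v y))"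
      using C D xy by (intro hcat_mult_vec[OF Vc Wc, symmetric]) auto
    also have "\<dots> = hcat V W *\<^sub>v (block_diag k l C D *\<^sub>v z)"
      using block_diag_mult_vec[OF C D xy(1,2)] xy(3) by simp
    also have "\<dots> = (hcat V W * block_diag k l C D) *\<^sub>v z"
      using assoc_mult_mat_vec[OF hcat_carrier[OF Vc Wc] four_block_carrier_mat[OF C D] z] by simp
    finally show "(B * hcat V W) *\<^sub>v z = (hcat V W * block_diag k l C D) *\<^sub>v z" .
  qed
  with inj show ?thesis by (simp add: intertwiners_def)
qed

lemma hcat_eqD:
  fixes V W :: "'a :: field mat"
  assumes c: "V \<in> carrier_mat n k" "W \<in> carrier_mat n l" "V' \<in> carrier_mat n k" "W' \<in> carrier_mat n l"
    and eq: "hcat V W = hcat V' W'"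
  shows "V = V'" "W = W'"
proof -
  show "V = V'"
  proof (rule eq_matI)
    fix i j assume "i < dim_row V'" "j < dim_col V'"
    then have "hcat V W $$ (i, j) = V $$ (i, j)" "hcat V' W' $$ (i, j) = V' $$ (i, j)"
      using c by (auto simp: hcat_def)
    then show "V $$ (i, j) = V' $$ (i, j)" using eq by simp
  qed (use c in auto)
  show "W = W'"
  proof (rule eq_matI)
    fix i j assume "i < dim_row W'" "j < dim_col W'"
    then have "hcat V W $$ (i, k + j) = W $$ (i, j)" "hcat V' W' $$ (i, k + j) = W' $$ (i, j)"
      using c by (auto simp: hcat_def)
    then show "W $$ (i, j) = W' $$ (i, j)" using eq by simp
  qed (use c in auto)
qed

section \<open>Embeddings of the simple modules \<open>F[x]/(f)\<close>\<close>

definition embeddings :: "nat \<Rightarrow> 'a :: field mat \<Rightarrow> 'a poly \<Rightarrow> 'a mat set" where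
  "embeddings n B f = intertwiners n (degree f) B (companion f)"

lemma finite_embeddings: "finite (embeddings n (B :: 'a :: {field, finite} mat) f)"
  by (simp add: embeddings_def finite_intertwiners)

lemma sum_card_embeddings:
  fixes f :: "'a :: {field, finite} poly"
  assumes "f \<in> monic_irreducibles" "\<not> f dvd [:0, 1:]" "degree f < n"
  shows "(\<Sum>B\<in>carrier (SL n). card (embeddings n B f)) = card (carrier (SL n :: 'a mat monoid))"
  unfolding embeddings_def using assms
  by (intro sum_card_intertwiners companion_inj_mats coprime_monic_irreducible monic_irreducibles_degree)

text \<open>For irreducible polynomials the modules are simple. If the concatenation is not an
  embedding of the direct sum, the two images share a nonzero vector; its annihilator is both
  \<open>(f)\<close> and \<open>(g)\<close>, and it generates both images.\<close>

lemma embeddings_disjoint_or_same: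
  assumes B: "B \<in> carrier_mat n n"
    and f: "f \<in> monic_irreducibles" and g: "g \<in> monic_irreducibles"
    and V: "V \<in> embeddings n B f" and W: "W \<in> embeddings n B g"
    and not: "hcat V W \<notin> intertwiners n (degree f + degree g) B
      (block_diag (degree f) (degree g) (companion f) (companion g))"
  shows "f = g" "W *\<^sub>v poly_vec g 1 \<in> (\<lambda>x. V *\<^sub>v x) ` carrier_vec (degree f)"
proof -
  have df: "degree f > 0" and dg: "degree g > 0"
    using f g by (auto dest: monic_irreducibles_degree)
  note V = V[unfolded embeddings_def] and W = W[unfolded embeddings_def]
  define v w where "v = V *\<^sub>v poly_vec f 1" and "w = W *\<^sub>v poly_vec g 1"
  have vw: "v \<in> carrier_vec n" "w \<in> carrier_vec n"
    using intertwiner_generator_carrier[OF df B V] intertwiner_generator_carrier[OF dg B W]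
    by (simp_all add: v_def w_def)
  have v0: "mat_poly n B p *\<^sub>v v = 0\<^sub>v n \<longleftrightarrow> f dvd p" for p
    unfolding v_def by (rule mat_poly_intertwiner_eq_0_iff[OF df B V])
  have w0: "mat_poly n B p *\<^sub>v w = 0\<^sub>v n \<longleftrightarrow> g dvd p" for p
    unfolding w_def by (rule mat_poly_intertwiner_eq_0_iff[OF dg B W])
  have "hcat V W \<notin> inj_mats n (degree f + degree g)"
    using hcat_intertwiner[OF B companion_carrier companion_carrier V W] not by blast
  then obtain x y where xy: "x \<in> carrier_vec (degree f)" "y \<in> carrier_vec (degree g)"
    "V *\<^sub>v x = W *\<^sub>v y" "x \<noteq> 0\<^sub>v (degree f)"
    using hcat_inj_mats[OF intertwiner_inj[OF df B V] intertwiner_inj[OF dg B W]] by blast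
  obtain p where p: "x = poly_vec f p" using poly_vec_surj[OF df xy(1)] by blast
  obtain r where r: "y = poly_vec g r" using poly_vec_surj[OF dg xy(2)] by blast
  have pr: "mat_poly n B p *\<^sub>v v = mat_poly n B r *\<^sub>v w"
    using xy(3) intertwiner_poly_vec[OF df B V, of p] intertwiner_poly_vec[OF dg B W, of r]
    by (simp only: p r v_def w_def)
  have fp: "\<not> f dvd p" using xy(4) by (simp add: p poly_vec_eq_0_iff[OF df])
  \<comment> \<open>The common vector \<open>p(B) v = r(B) w\<close> is killed by
    \<open>g(B)\<close>, so \<open>f\<close> divides \<open>p * g\<close> although it does not
    divide \<open>p\<close>.\<close>
  have "mat_poly n B (p * g) *\<^sub>v v = mat_poly n B g *\<^sub>v (mat_poly n B p *\<^sub>v v)"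
    using vw by (simp add: mat_poly_mult_vec[OF B, symmetric] mult.commute)
  also have "\<dots> = mat_poly n B (g * r) *\<^sub>v w"
    unfolding pr using vw by (simp add: mat_poly_mult_vec[OF B])
  also have "\<dots> = 0\<^sub>v n" by (simp add: w0)
  finally have "f dvd p * g" by (simp add: v0)
  with fp have "f dvd g" using coprime_monic_irreducible[OF f] coprime_dvd_mult_poly by blast
  then show fg: "f = g" using f g by (rule monic_irreducibles_dvd_imp_eq[rotated 2])
  have "\<not> g dvd r" using fp v0[of p] pr w0[of r] by simp
  \<comment> \<open>\<open>r\<close> is invertible modulo \<open>g\<close>, so \<open>w\<close> is
    recovered from the common vector: \<open>w = u(B) r(B) w = u(B) p(B) v\<close>.\<close>
  then obtain u s where us: "u * r + s * g = 1"
    using bezout_poly[OF coprime_monic_irreducible[OF g]] by (metis add.commute)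
  have "w = mat_poly n B (u * r + s * g) *\<^sub>v w"
    using vw by (simp add: us mat_poly_1_vec[OF B])
  also have "\<dots> = mat_poly n B (u * r) *\<^sub>v w + mat_poly n B (s * g) *\<^sub>v w"
    using vw by (simp add: mat_poly_add_vec[OF B])
  also have "mat_poly n B (s * g) *\<^sub>v w = 0\<^sub>v n" by (simp add: w0)
  also have "mat_poly n B (u * r) *\<^sub>v w = mat_poly n B (u * p) *\<^sub>v v"
    using vw by (simp add: mat_poly_mult_vec[OF B] pr)
  also have "\<dots> + 0\<^sub>v n = mat_poly n B (u * p) *\<^sub>v v" using vw B by simp
  also have "\<dots> = V *\<^sub>v poly_vec f (u * p)"
    using intertwiner_poly_vec[OF df B V, of "u * p"] by (simp only: v_def)
  finally show "W *\<^sub>v poly_vec g 1 \<in> (\<lambda>x. V *\<^sub>v x) ` carrier_vec (degree f)"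
    unfolding w_def by (rule image_eqI) simp
qed

lemma hcat_inj_on_embeddings:
  "inj_on (\<lambda>(V, W). hcat V W) (embeddings n B f \<times> embeddings n B g)"
proof (rule inj_onI, clarify)
  fix V W V' W'
  assume "V \<in> embeddings n B f" "W \<in> embeddings n B g" "V' \<in> embeddings n B f" "W' \<in> embeddings n B g"
    and eq: "hcat V W = hcat V' W'"
  then have "V \<in> carrier_mat n (degree f)" "W \<in> carrier_mat n (degree g)"
    "V' \<in> carrier_mat n (degree f)" "W' \<in> carrier_mat n (degree g)"
    by (auto simp: embeddings_def intertwiners_def inj_mats_def)
  from hcat_eqD[OF this eq] show "V = V' \<and> W = W'" by simp
qed

text \<open>Pairs whose concatenation embeds the direct sum are bounded by the first term, as
  \<open>hcat\<close> is injective. The others occur only for \<open>f = g\<close>; then the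
  generator of \<open>W\<close> lies in the image of \<open>V\<close>, which has at most
  \<open>q ^ degree f\<close> vectors, and this generator determines \<open>W\<close>.\<close>

lemma card_embeddings_mult_le:
  fixes B :: "'a :: {field, finite} mat"
  assumes B: "B \<in> carrier_mat n n"
    and f: "f \<in> monic_irreducibles" and g: "g \<in> monic_irreducibles"
  shows "card (embeddings n B f) * card (embeddings n B g) \<le>
    card (intertwiners n (degree f + degree g) B
      (block_diag (degree f) (degree g) (companion f) (companion g))) +
    (if f = g then CARD('a) ^ degree f * card (embeddings n B f) else 0)"
proof -
  let ?I = "intertwiners n (degree f + degree g) B
      (block_diag (degree f) (degree g) (companion f) (companion g))"
  let ?P = "embeddings n B f \<times> embeddings n B g"
  define P1 where "P1 = {VW \<in> ?P. hcat (fst VW) (snd VW) \<in> ?I}"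
  define P2 where "P2 = {VW \<in> ?P. hcat (fst VW) (snd VW) \<notin> ?I}"
  have fin: "finite P1" "finite P2"
    unfolding P1_def P2_def by (auto intro!: finite_subset[of _ ?P] finite_cartesian_product finite_embeddings)
  have "card (embeddings n B f) * card (embeddings n B g) = card (P1 \<union> P2)"
    unfolding card_cartesian_product[symmetric] P1_def P2_def by (rule arg_cong[of _ _ card]) blast
  also have "\<dots> \<le> card P1 + card P2" by (rule card_Un_le)
  also have "card P1 \<le> card ?I"
  proof (rule card_inj_on_le)
    show "inj_on (\<lambda>(V, W). hcat V W) P1"
      by (rule inj_on_subset[OF hcat_inj_on_embeddings]) (auto simp: P1_def)
    show "(\<lambda>(V, W). hcat V W) ` P1 \<subseteq> ?I" by (auto simp: P1_def)
  qed (rule finite_intertwiners)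
  also have "card P2 \<le> (if f = g then CARD('a) ^ degree f * card (embeddings n B f) else 0)"
  proof (cases "f = g")
    case False
    then have "P2 = {}" using embeddings_disjoint_or_same(1)[OF B f g] by (auto simp: P2_def)
    then show ?thesis by simp
  next
    case True
    let ?S = "\<lambda>V. {W \<in> embeddings n B f. W *\<^sub>v poly_vec f 1 \<in> (\<lambda>x. V *\<^sub>v x) ` carrier_vec (degree f)}"
    have "P2 \<subseteq> Sigma (embeddings n B f) ?S"
      using embeddings_disjoint_or_same(2)[OF B f g] True by (auto simp: P2_def)
    then have "card P2 \<le> card (Sigma (embeddings n B f) ?S)"
      by (rule card_mono[rotated]) (auto intro!: finite_SigmaI finite_embeddings finite_subset[OF _ finite_embeddings[of n B f]])
    also have "\<dots> = (\<Sum>V\<in>embeddings n B f. card (?S V))"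
      by (intro card_SigmaI finite_embeddings ballI finite_subset[OF _ finite_embeddings[of n B f]]) auto
    also have "\<dots> \<le> (\<Sum>V\<in>embeddings n B f. CARD('a) ^ degree f)"
    proof (rule sum_mono)
      fix V
      have "card (?S V) \<le> card ((\<lambda>x. V *\<^sub>v x) ` (carrier_vec (degree f) :: 'a vec set))"
      proof (rule card_inj_on_le)
        show "inj_on (\<lambda>W. W *\<^sub>v poly_vec f 1) (?S V)"
          by (rule inj_on_subset[OF intertwiner_generator_inj[OF monic_irreducibles_degree[OF f] B]])
            (auto simp: embeddings_def)
      qed (auto intro: carrier_vec_card)
      also have "\<dots> \<le> card (carrier_vec (degree f) :: 'a vec set)"
        by (intro card_image_le carrier_vec_card)
      finally show "card (?S V) \<le> CARD('a) ^ degree f" by (simp add: carrier_vec_card)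
    qed
    finally show ?thesis using True by (simp add: mult.commute)
  qed
  finally show ?thesis by simp
qed

text \<open>Both terms of the pointwise bound are summed exactly by the first moment identity,
  applied to the block diagonal matrix of size \<open>degree f + degree g\<close> and to
  \<open>companion f\<close>.\<close>

lemma sum_card_embeddings_mult_le:
  fixes f :: "'a :: {field, finite} poly"
  assumes f: "f \<in> monic_irreducibles" "\<not> f dvd [:0, 1:]"
    and g: "g \<in> monic_irreducibles" "\<not> g dvd [:0, 1:]"
    and n: "degree f + degree g < n"
  shows "(\<Sum>B\<in>carrier (SL n). card (embeddings n B f) * card (embeddings n B g)) \<le>
    card (carrier (SL n :: 'a mat monoid)) * (1 + (if f = g then CARD('a) ^ degree f else 0))"
proof -
  let ?G = "carrier (SL n :: 'a mat monoid)"
  have inj: "companion f \<in> inj_mats (degree f) (degree f)" "companion g \<in> inj_mats (degree g) (degree g)"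
    using f g by (auto intro!: companion_inj_mats coprime_monic_irreducible monic_irreducibles_degree)
  have "(\<Sum>B\<in>?G. card (embeddings n B f) * card (embeddings n B g)) \<le>
    (\<Sum>B\<in>?G. card (intertwiners n (degree f + degree g) B
      (block_diag (degree f) (degree g) (companion f) (companion g))) +
      (if f = g then CARD('a) ^ degree f else 0) * card (embeddings n B f))"
  proof (rule sum_mono)
    fix B assume "B \<in> ?G"
    then have "B \<in> carrier_mat n n" by (simp add: carrier_SL_iff)
    from card_embeddings_mult_le[OF this f(1) g(1)]
    show "card (embeddings n B f) * card (embeddings n B g) \<le>
      card (intertwiners n (degree f + degree g) B
        (block_diag (degree f) (degree g) (companion f) (companion g))) +
      (if f = g then CARD('a) ^ degree f else 0) * card (embeddings n B f)"
      by (cases "f = g") simp_all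
  qed
  also have "\<dots> = card ?G + (if f = g then CARD('a) ^ degree f else 0) * card ?G"
    unfolding sum.distrib sum_distrib_left[symmetric]
    using sum_card_intertwiners[OF block_diag_inj_mats[OF inj] n] sum_card_embeddings[OF f] n by simp
  finally show ?thesis by (simp add: algebra_simps)
qed

text \<open>Chebyshev's inequality for \<open>\<Sum>f\<in>T. card (embeddings n B f) / q ^ degree f\<close>, whose mean
  \<open>mu\<close> over \<open>B\<close> also bounds its variance.\<close>

lemma card_no_embedding_le:
  fixes T :: "'a :: {field, finite} poly set" and n :: nat
  defines "mu \<equiv> \<Sum>f\<in>T. 1 / real CARD('a) ^ degree f"
  assumes fin: "finite T" and T: "T \<subseteq> monic_irreducibles" and X: "\<And>f. f \<in> T \<Longrightarrow> \<not> f dvd [:0, 1:]"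
    and n: "\<And>f. f \<in> T \<Longrightarrow> 2 * degree f < n" and mu: "mu > 0"
  shows "real (card {B \<in> carrier (SL n :: 'a mat monoid). \<forall>f\<in>T. embeddings n B f = {}}) * mu
    \<le> real (card (carrier (SL n :: 'a mat monoid)))"
proof -
  let ?G = "carrier (SL n :: 'a mat monoid)"
  define bad where "bad = {B \<in> ?G. \<forall>f\<in>T. embeddings n B f = {}}"
  define Q where "Q = real (card ?G)"
  \<comment> \<open>The weight is the reciprocal of the excess \<open>q ^ degree f\<close> in the
    second moment for \<open>f\<close>, so the diagonal terms \<open>a f * a f / a f\<close> add up
    to \<open>mu\<close>.\<close>
  define a where "a = (\<lambda>f :: 'a poly. 1 / real CARD('a) ^ degree f)"
  define E where "E = (\<lambda>B f. real (card (embeddings n B (f :: 'a poly))))"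
  define S where "S = (\<lambda>B. \<Sum>f\<in>T. a f * E B f)"
  have q: "real CARD('a) > 0" by simp
  have a0: "a f > 0" for f using q by (simp add: a_def)
  have finG: "finite ?G" by (rule finite_carrier_SL)
  have mu_a: "mu = (\<Sum>f\<in>T. a f)" by (simp add: mu_def a_def)
  have first: "(\<Sum>B\<in>?G. E B f) = Q" if "f \<in> T" for f
  proof -
    have "(\<Sum>B\<in>?G. card (embeddings n B f)) = card ?G"
      using that T X n[OF that] by (intro sum_card_embeddings) auto
    then show ?thesis unfolding E_def Q_def by (metis of_nat_sum)
  qed
  have second: "(\<Sum>B\<in>?G. E B f * E B g) \<le> Q * (1 + (if f = g then 1 / a f else 0))"
    if fg: "f \<in> T" "g \<in> T" for f g
  proof -
    have "degree f + degree g < n" using n[OF fg(1)] n[OF fg(2)] by linarith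
    then have "(\<Sum>B\<in>?G. card (embeddings n B f) * card (embeddings n B g)) \<le>
      card ?G * (1 + (if f = g then CARD('a) ^ degree f else 0))"
      using fg T X by (intro sum_card_embeddings_mult_le) auto
    then have "real (\<Sum>B\<in>?G. card (embeddings n B f) * card (embeddings n B g)) \<le>
      real (card ?G * (1 + (if f = g then CARD('a) ^ degree f else 0)))"
      by (simp only: of_nat_le_iff)
    then show ?thesis by (simp add: E_def Q_def a_def distrib_left split: if_splits)
  qed
  have S1: "(\<Sum>B\<in>?G. S B) = mu * Q"
  proof -
    have "(\<Sum>B\<in>?G. S B) = (\<Sum>f\<in>T. a f * (\<Sum>B\<in>?G. E B f))"
      unfolding S_def sum_distrib_left by (rule sum.swap)
    also have "\<dots> = mu * Q" by (simp add: first mu_a sum_distrib_right)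
    finally show ?thesis .
  qed
  have S2: "(\<Sum>B\<in>?G. S B * S B) \<le> (mu * mu + mu) * Q"
  proof -
    have "(\<Sum>B\<in>?G. S B * S B) = (\<Sum>B\<in>?G. \<Sum>f\<in>T. \<Sum>g\<in>T. a f * a g * (E B f * E B g))"
      unfolding S_def sum_product by (intro sum.cong refl) (simp add: mult_ac)
    also have "\<dots> = (\<Sum>f\<in>T. \<Sum>g\<in>T. \<Sum>B\<in>?G. a f * a g * (E B f * E B g))"
      by (subst sum.swap, rule sum.cong[OF refl], rule sum.swap)
    also have "\<dots> = (\<Sum>f\<in>T. \<Sum>g\<in>T. a f * a g * (\<Sum>B\<in>?G. E B f * E B g))"
      by (simp add: sum_distrib_left)
    also have "\<dots> \<le> (\<Sum>f\<in>T. \<Sum>g\<in>T. a f * a g * (Q * (1 + (if f = g then 1 / a f else 0))))"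
      using a0 by (intro sum_mono mult_left_mono second) (auto simp: less_imp_le)
    also have "\<dots> = (\<Sum>f\<in>T. \<Sum>g\<in>T. Q * (a f * a g) + (if f = g then Q * a f else 0))"
      using less_imp_neq[OF a0] by (intro sum.cong refl) (auto simp: algebra_simps)
    also have "\<dots> = Q * (\<Sum>f\<in>T. \<Sum>g\<in>T. a f * a g) + Q * (\<Sum>f\<in>T. a f)"
      using fin by (simp add: sum.distrib sum_distrib_left)
    also have "\<dots> = (mu * mu + mu) * Q"
      unfolding mu_a sum_product[symmetric] by (simp add: algebra_simps)
    finally show ?thesis .
  qed
  have "(\<Sum>B\<in>?G. (S B - mu)\<^sup>2) = (\<Sum>B\<in>?G. S B * S B) - 2 * mu * (\<Sum>B\<in>?G. S B) + Q * mu * mu"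
    by (simp add: power2_eq_square algebra_simps sum.distrib sum_subtractf sum_distrib_left Q_def)
  also have "\<dots> \<le> mu * Q" using S1 S2 by (simp add: algebra_simps)
  finally have var: "(\<Sum>B\<in>?G. (S B - mu)\<^sup>2) \<le> mu * Q" .
  \<comment> \<open>On \<open>bad\<close> all counts vanish, so \<open>S B = 0\<close> and every
    such \<open>B\<close> contributes the full square of \<open>mu\<close> to the variance
    sum.\<close>
  have "real (card bad) * mu\<^sup>2 = (\<Sum>B\<in>bad. (S B - mu)\<^sup>2)"
  proof -
    have "S B = 0" if "B \<in> bad" for B using that by (simp add: S_def E_def bad_def)
    then show ?thesis by simp
  qed
  also have "\<dots> \<le> (\<Sum>B\<in>?G. (S B - mu)\<^sup>2)"
    using finG by (intro sum_mono2) (auto simp: bad_def)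
  also note var
  finally have "(real (card bad) * mu) * mu \<le> Q * mu" by (simp add: power2_eq_square mult_ac)
  then have "real (card bad) * mu \<le> Q" using mu by simp
  then show ?thesis by (simp add: bad_def Q_def)
qed

section \<open>Fibres of the power map\<close>

text \<open>Multiplication by \<open>x\<close> permutes the nonzero elements, so their nonzero
  product absorbs the factor \<open>x ^ (q - 1)\<close>.\<close>

lemma finite_field_power_card:
  fixes x :: "'a :: {field, finite}"
  assumes "x \<noteq> 0"
  shows "x ^ (CARD('a) - 1) = 1"
proof -
  let ?U = "UNIV - {0 :: 'a}"
  have "bij_betw (\<lambda>y. x * y) ?U ?U"
    using assms by (intro bij_betwI[where g = "\<lambda>y. y / x"]) auto
  from prod.reindex_bij_betw[OF this, of "\<lambda>y. y"]
  have "(\<Prod>y\<in>?U. x * y) = \<Prod>?U" by simp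
  then have "x ^ card ?U * \<Prod>?U = \<Prod>?U" by (simp add: prod.distrib)
  moreover have "\<Prod>?U \<noteq> 0" by simp
  ultimately show ?thesis by (simp add: card_Diff_singleton)
qed

lemma mat_poly_smult_vec:
  assumes B: "B \<in> carrier_mat n n" and v: "v \<in> carrier_vec n"
  shows "mat_poly n B (Polynomial.smult c p) *\<^sub>v v = c \<cdot>\<^sub>v (mat_poly n B p *\<^sub>v v)"
  using assms by (intro eq_vecI) (auto simp: mat_poly_smult row_smult mat_poly_dim)

lemma one_pow_mat: "1\<^sub>m n ^\<^sub>m j = (1\<^sub>m n :: 'a :: semiring_1 mat)"
  by (induction j) auto

lemma SL_pow:
  assumes "A \<in> carrier (SL n)"
  shows "A [^]\<^bsub>SL n\<^esub> (j :: nat) = A ^\<^sub>m j"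
proof -
  have "dim_row A = n" using assms by (auto simp: carrier_SL_iff)
  then show ?thesis by (induction j) (simp_all add: mult_SL one_SL)
qed

text \<open>\<open>B\<close> has finite order in a finite group. Hence \<open>X ^ m - 1\<close>
  annihilates \<open>B\<close>; it takes the place of the characteristic polynomial below.\<close>

lemma SL_annihilated:
  fixes B :: "'a :: {field, finite} mat"
  assumes B: "B \<in> carrier (SL n)"
  shows "\<exists>m > 0. mat_poly n B ([:0, 1:] ^ m) = 1\<^sub>m n"
proof -
  interpret group "SL n :: 'a mat monoid" by (rule group_SL)
  have Bc: "B \<in> carrier_mat n n" using B by (simp add: carrier_SL_iff)
  have "\<not> inj (\<lambda>j :: nat. B [^]\<^bsub>SL n\<^esub> j)"
  proof
    assume "inj (\<lambda>j :: nat. B [^]\<^bsub>SL n\<^esub> j)"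
    moreover have "finite (range (\<lambda>j :: nat. B [^]\<^bsub>SL n\<^esub> j))"
      using B by (intro finite_subset[OF _ finite_carrier_SL[of n]]) auto
    ultimately show False using finite_imageD infinite_UNIV_nat by blast
  qed
  then obtain i j :: nat where "B [^]\<^bsub>SL n\<^esub> i = B [^]\<^bsub>SL n\<^esub> j" "i < j"
    unfolding inj_def by (metis linorder_neqE_nat)
  then have "B [^]\<^bsub>SL n\<^esub> (j - i) = \<one>\<^bsub>SL n\<^esub>" using pow_eq_div2[OF B, of j i] by simp
  then have "mat_poly n B ([:0, 1:] ^ (j - i)) = 1\<^sub>m n"
    using B by (simp add: SL_pow one_SL mat_poly_power[OF Bc] mat_poly_X[OF Bc])
  with \<open>i < j\<close> show ?thesis by (meson zero_less_diff)
qed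

text \<open>Chinese remainder theorem for \<open>h = a * b\<close>: \<open>e = w * b\<close> is 1
  modulo \<open>a\<close> and 0 modulo \<open>b\<close>, hence idempotent modulo \<open>h\<close>.
  On the kernel of \<open>f(B)\<close> the cofactor not divisible by \<open>f\<close> is invertible,
  so the other cofactor acts as zero.\<close>

lemma idempotent_polynomial:
  fixes B :: "'a :: field mat"
  assumes B: "B \<in> carrier_mat n n" and h: "h \<noteq> 0" "mat_poly n B h = 0\<^sub>m n n"
  shows "\<exists>e. h dvd e * e - e \<and> (\<forall>f\<in>monic_irreducibles. \<forall>v\<in>carrier_vec n.
    mat_poly n B f *\<^sub>v v = 0\<^sub>v n \<longrightarrow> mat_poly n B e *\<^sub>v v = (if f \<in> S then v else 0\<^sub>v n))"
proof -
  from coprime_splitting[OF h(1), of S] obtain a b where ab: "h = a * b" "coprime a b"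
    "\<forall>f\<in>monic_irreducibles. f dvd a \<longrightarrow> f \<in> S"
    "\<forall>f\<in>monic_irreducibles. f dvd b \<longrightarrow> f \<notin> S"
    by (elim exE conjE) (rule that)
  obtain u w where uw: "u * a + w * b = 1" using bezout_poly[OF ab(2)] by blast
  define e where "e = w * b"
  have "e * e - e = e * (e - 1)" by (simp add: algebra_simps)
  also have "e - 1 = - (u * a)" using uw by (simp add: e_def algebra_simps)
  also have "e * (- (u * a)) = h * (- (w * u))" by (simp add: e_def ab(1) mult_ac)
  finally have "h dvd e * e - e" by simp
  moreover have "mat_poly n B e *\<^sub>v v = (if f \<in> S then v else 0\<^sub>v n)"
    if f: "f \<in> monic_irreducibles" and v: "v \<in> carrier_vec n" "mat_poly n B f *\<^sub>v v = 0\<^sub>v n" for f v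
  proof -
    have hv: "mat_poly n B h *\<^sub>v v = 0\<^sub>v n" using v(1) by (auto simp: h(2) intro!: eq_vecI)
    \<comment> \<open>\<open>a'(B) v\<close> is killed by the coprime polynomials \<open>f\<close>
      and \<open>b'\<close>, hence is zero.\<close>
    have kill: "mat_poly n B a' *\<^sub>v v = 0\<^sub>v n" if "\<not> f dvd b'" "h = b' * a'" for a' b'
    proof (rule mat_poly_coprime_vec[OF B])
      show "coprime f b'" using f that(1) by (rule coprime_monic_irreducible)
      show "mat_poly n B f *\<^sub>v (mat_poly n B a' *\<^sub>v v) = 0\<^sub>v n"
        using v mat_poly_mult_vec[OF B v(1), of f a'] mat_poly_mult_vec[OF B v(1), of a' f]
          mat_poly_zero_vec[OF B] by (simp add: mult.commute)
      show "mat_poly n B b' *\<^sub>v (mat_poly n B a' *\<^sub>v v) = 0\<^sub>v n"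
        using mat_poly_mult_vec[OF B v(1), of b' a'] hv that(2) by simp
    qed (use B v in auto)
    show ?thesis
    proof (cases "f \<in> S")
      case True
      then have "mat_poly n B a *\<^sub>v v = 0\<^sub>v n"
        using kill[of b a] ab f by (auto simp: mult.commute)
      then have "mat_poly n B (u * a) *\<^sub>v v = 0\<^sub>v n"
        using B v by (simp add: mat_poly_mult_vec)
      moreover have "v = mat_poly n B (u * a) *\<^sub>v v + mat_poly n B e *\<^sub>v v"
        using mat_poly_add_vec[OF B v(1), of "u * a" e] uw mat_poly_1_vec[OF B v(1)] by (simp add: e_def)
      ultimately show ?thesis using True B v by simp
    next
      case False
      then have "mat_poly n B b *\<^sub>v v = 0\<^sub>v n"
        using kill[of a b] ab f by auto
      then show ?thesis using B v False by (simp add: e_def mat_poly_mult_vec)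
    qed
  qed
  ultimately show ?thesis by blast
qed

text \<open>Used with \<open>d\<close> a determinant: making all candidates share one determinant
  costs only a factor \<open>q\<close>.\<close>

lemma card_Pow_pigeonhole:
  fixes d :: "'b set \<Rightarrow> 'a :: finite"
  assumes "finite F"
  shows "\<exists>x. 2 ^ card F \<le> CARD('a) * card {S \<in> Pow F. d S = x}"
proof (rule ccontr)
  assume "\<not> ?thesis"
  then have less: "CARD('a) * card {S \<in> Pow F. d S = x} < 2 ^ card F" for x
    by (simp add: not_le)
  have "card (Pow F) = (\<Sum>x\<in>(UNIV :: 'a set). card {S \<in> Pow F. d S = x})"
  proof -
    have "Pow F = (\<Union>x\<in>(UNIV :: 'a set). {S \<in> Pow F. d S = x})" by auto
    then have "card (Pow F) = card (\<Union>x\<in>(UNIV :: 'a set). {S \<in> Pow F. d S = x})" by simp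
    also have "\<dots> = (\<Sum>x\<in>(UNIV :: 'a set). card {S \<in> Pow F. d S = x})"
      using assms by (intro card_UN_disjoint) auto
    finally show ?thesis .
  qed
  then have "CARD('a) * 2 ^ card F = (\<Sum>x\<in>(UNIV :: 'a set). CARD('a) * card {S \<in> Pow F. d S = x})"
    using assms by (simp add: card_Pow sum_distrib_left)
  also have "\<dots> < (\<Sum>x\<in>(UNIV :: 'a set). 2 ^ card F)"
    using less by (intro sum_strict_mono) auto
  finally show False by simp
qed

text \<open>The products of \<open>B\<close> with the matrices \<open>z\<close> may leave
  \<open>SL n\<close>. Each \<open>z\<close> is therefore divided by a fixed one of equal
  determinant; the quotient still commutes with \<open>B\<close> and has \<open>(q - 1)\<close>-st
  power 1. The factor \<open>q\<close> on the right comes from fixing the determinant.\<close>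

lemma power_fibre_card:
  fixes B :: "'a :: {field, finite} mat"
  assumes BG: "B \<in> carrier (SL n)" and q: "CARD('a) > 2"
    and F: "finite F" "F \<subseteq> monic_irreducibles" and emb: "\<And>f. f \<in> F \<Longrightarrow> embeddings n B f \<noteq> {}"
  shows "2 ^ card F \<le> CARD('a) * card {A \<in> carrier (SL n). A ^\<^sub>m (CARD('a) - 1) = B ^\<^sub>m (CARD('a) - 1)}"
proof -
  let ?q = "CARD('a)" and ?P = "mat_poly n B" and ?X = "[:0, 1 :: 'a:]"
  have B: "B \<in> carrier_mat n n" and detB: "det B = 1" using BG by (auto simp: carrier_SL_iff)
  obtain m where m: "m > 0" "?P (?X ^ m) = 1\<^sub>m n" using SL_annihilated[OF BG] by blast
  define h where "h = ?X ^ m - 1"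
  \<comment> \<open>Since \<open>m > 0\<close>, the constant term of \<open>h\<close> is -1.\<close>
  have "poly h 0 \<noteq> 0" using m(1) by (simp add: h_def power_0_left)
  then have h0: "h \<noteq> 0" by auto
  have Ph: "?P h = 0\<^sub>m n n"
  proof -
    have eq: "?P h + 1\<^sub>m n = 1\<^sub>m n"
      using mat_poly_add[OF B, of h 1] m(2) by (simp add: h_def mat_poly_1[OF B])
    show ?thesis
    proof (rule eq_matI)
      fix i j assume ij: "i < dim_row (0\<^sub>m n n :: 'a mat)" "j < dim_col (0\<^sub>m n n :: 'a mat)"
      then have "(?P h + 1\<^sub>m n) $$ (i, j) = ?P h $$ (i, j) + 1\<^sub>m n $$ (i, j)" by simp
      with eq ij show "?P h $$ (i, j) = 0\<^sub>m n n $$ (i, j)" by simp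
    qed (use mat_poly_dim[OF B] in auto)
  qed
  \<comment> \<open>The value at \<open>B\<close> depends only on the class modulo \<open>h\<close>,
    so idempotency modulo \<open>h\<close> becomes idempotency of the matrix.\<close>
  have cong: "?P p = ?P r" if dvd: "h dvd p - r" for p r
  proof -
    obtain k where "p - r = h * k" using dvd by blast
    then have "p = r + h * k" by (simp add: algebra_simps)
    then have "?P p = ?P r + 0\<^sub>m n n * ?P k"
      by (simp add: mat_poly_add[OF B] mat_poly_mult[OF B] Ph)
    also have "0\<^sub>m n n * ?P k = 0\<^sub>m n n" by (rule left_mult_zero_mat[OF mat_poly_carrier[OF B]])
    also have "?P r + 0\<^sub>m n n = ?P r" by (rule right_add_zero_mat[OF mat_poly_carrier[OF B]])
    finally show ?thesis .
  qed
  have "\<forall>S. \<exists>e. h dvd e * e - e \<and> (\<forall>f\<in>monic_irreducibles. \<forall>v\<in>carrier_vec n.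
      ?P f *\<^sub>v v = 0\<^sub>v n \<longrightarrow> ?P e *\<^sub>v v = (if f \<in> S then v else 0\<^sub>v n))"
    using idempotent_polynomial[OF B h0 Ph] by blast
  then obtain e where e: "\<And>S. h dvd e S * e S - e S"
    and e_vec: "\<And>S f v. f \<in> monic_irreducibles \<Longrightarrow> v \<in> carrier_vec n \<Longrightarrow> ?P f *\<^sub>v v = 0\<^sub>v n \<Longrightarrow>
      ?P (e S) *\<^sub>v v = (if f \<in> S then v else 0\<^sub>v n)"
    by metis
  have "\<not> UNIV \<subseteq> {0 :: 'a, 1}"
  proof
    assume "UNIV \<subseteq> {0 :: 'a, 1}"
    then have "?q \<le> card {0 :: 'a, 1}" by (intro card_mono) auto
    with q show False by simp
  qed
  then obtain l :: 'a where l: "l \<noteq> 0" "l \<noteq> 1" by blast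
  \<comment> \<open>At \<open>B\<close> this acts as \<open>l\<close> on the image of the idempotent
    for \<open>S\<close> and as 1 on its kernel.\<close>
  define z where "z = (\<lambda>S. 1 + Polynomial.smult (l - 1) (e S))"
  \<comment> \<open>By idempotency a power of \<open>z S\<close> only replaces the scalar
    \<open>l\<close> by \<open>l ^ j\<close>, which is 1 for \<open>j = q - 1\<close>.\<close>
  have z_pow: "?P (z S ^ j) = ?P (1 + Polynomial.smult (l ^ j - 1) (e S))" for S j
  proof (induction j)
    case (Suc j)
    have "?P (z S ^ Suc j) = ?P (z S ^ j) * ?P (z S)"
      unfolding power_Suc2 by (rule mat_poly_mult[OF B])
    also have "\<dots> = ?P ((1 + Polynomial.smult (l ^ j - 1) (e S)) * z S)"
      by (simp only: Suc mat_poly_mult[OF B])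
    also have "\<dots> = ?P (1 + Polynomial.smult (l ^ Suc j - 1) (e S))"
    proof (rule cong)
      have "(1 + Polynomial.smult (l ^ j - 1) (e S)) * z S - (1 + Polynomial.smult (l ^ Suc j - 1) (e S))
        = Polynomial.smult ((l ^ j - 1) * (l - 1)) (e S * e S - e S)"
        by (simp add: z_def algebra_simps smult_diff_left smult_diff_right smult_add_left smult_add_right)
      then show "h dvd (1 + Polynomial.smult (l ^ j - 1) (e S)) * z S - (1 + Polynomial.smult (l ^ Suc j - 1) (e S))"
        using e by (simp add: dvd_smult)
    qed
    finally show ?case .
  qed simp
  have z_one: "?P (z S ^ (?q - 1)) = 1\<^sub>m n" for S
    using z_pow[of S "?q - 1"] finite_field_power_card[OF l(1)] by (simp add: mat_poly_1[OF B])
  have det_mult_P: "det (?P (p * r)) = det (?P p) * det (?P r)" for p r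
    unfolding mat_poly_mult[OF B] by (rule det_mult[of _ n]) (use B in auto)
  have det_pow_P: "det (?P (p ^ j)) = det (?P p) ^ j" for p j
    by (induction j) (simp_all add: mat_poly_1[OF B] det_mult_P)
  obtain d where d: "2 ^ card F \<le> ?q * card {S \<in> Pow F. det (?P (z S)) = d}"
    using card_Pow_pigeonhole[OF F(1), of "\<lambda>S. det (?P (z S))"] by blast
  define Fd where "Fd = {S \<in> Pow F. det (?P (z S)) = d}"
  have "Fd \<noteq> {}"
  proof
    assume "Fd = {}"
    then have "card Fd = 0" by simp
    with d show False unfolding Fd_def[symmetric] by simp
  qed
  then obtain S0 where S0: "S0 \<in> Fd" by blast
  \<comment> \<open>\<open>z S0 ^ (q - 2)\<close> evaluates to the inverse of \<open>z S0\<close> at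
    \<open>B\<close>, because \<open>z S0 ^ (q - 1)\<close> evaluates to 1.\<close>
  define A where "A = (\<lambda>S. ?P (?X * z S * z S0 ^ (?q - 2)))"
  have "card Fd \<le> card {A \<in> carrier (SL n). A ^\<^sub>m (?q - 1) = B ^\<^sub>m (?q - 1)}"
  proof (rule card_inj_on_le)
    show "inj_on A Fd"
    proof (rule inj_onI)
      fix S S' assume S: "S \<in> Fd" "S' \<in> Fd" "A S = A S'"
      \<comment> \<open>\<open>X ^ (m - 1)\<close> evaluates to the inverse of \<open>B\<close>, so
        this multiplication strips all factors of \<open>A S\<close> except
        \<open>z S\<close>.\<close>
      have recover: "?P (?X ^ (m - 1) * z S0) * A S = ?P (z S)" for S
      proof -
        have "Suc (?q - 2) = ?q - 1" "Suc (m - 1) = m" using q m(1) by simp_all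
        then have "z S0 * z S0 ^ (?q - 2) = z S0 ^ (?q - 1)" "?X ^ (m - 1) * ?X = ?X ^ m"
          by (metis power_Suc, metis power_Suc2)
        moreover have "?X ^ (m - 1) * z S0 * (?X * z S * z S0 ^ (?q - 2)) =
            (?X ^ (m - 1) * ?X) * (z S0 * z S0 ^ (?q - 2)) * z S"
          by (simp only: mult_ac)
        ultimately have "?X ^ (m - 1) * z S0 * (?X * z S * z S0 ^ (?q - 2)) = ?X ^ m * z S0 ^ (?q - 1) * z S"
          by (simp only:)
        then show ?thesis
          unfolding A_def mat_poly_mult[OF B, symmetric]
          using mat_poly_mult[OF B, of "?X ^ m * z S0 ^ (?q - 1)" "z S"]
            mat_poly_mult[OF B, of "?X ^ m" "z S0 ^ (?q - 1)"] m(2) z_one[of S0]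
            left_mult_one_mat[OF mat_poly_carrier[OF B, of "z S"]]
          by simp
      qed
      have Pz: "?P (z S) = ?P (z S')" using recover[of S] recover[of S'] S(3) by simp
      have "f \<in> S \<longleftrightarrow> f \<in> S'" if f: "f \<in> F" for f
      proof -
        have f': "f \<in> monic_irreducibles" "degree f > 0"
          using f F(2) by (auto intro: monic_irreducibles_degree)
        obtain V where V: "V \<in> intertwiners n (degree f) B (companion f)"
          using emb[OF f] by (auto simp: embeddings_def)
        \<comment> \<open>The generator of a copy of \<open>F[x]/(f)\<close> is an eigenvector of
          \<open>z S\<close> at \<open>B\<close>, with eigenvalue \<open>l\<close> if
          \<open>f\<close> lies in \<open>S\<close> and 1 otherwise. A nonzero coordinate of
          \<open>v\<close> tells the two cases apart.\<close>
        define v where "v = V *\<^sub>v poly_vec f 1"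
        have v: "v \<in> carrier_vec n"
          unfolding v_def by (rule intertwiner_generator_carrier[OF f'(2) B V])
        have v0: "?P p *\<^sub>v v = 0\<^sub>v n \<longleftrightarrow> f dvd p" for p
          unfolding v_def by (rule mat_poly_intertwiner_eq_0_iff[OF f'(2) B V])
        have "\<not> f dvd 1" using f'(1) by (simp add: monic_irreducibles_def irreducible_not_unit)
        then have "v \<noteq> 0\<^sub>v n" using v0[of 1] mat_poly_1_vec[OF B v] by simp
        then obtain i where i: "i < n" "v $ i \<noteq> 0"
          using v by (metis carrier_vecD eq_vecI index_zero_vec(1) index_zero_vec(2))
        have zv: "(?P (z S) *\<^sub>v v) $ i = (if f \<in> S then l * v $ i else v $ i)" for S
        proof -
          have "?P (z S) *\<^sub>v v = v + (l - 1) \<cdot>\<^sub>v (?P (e S) *\<^sub>v v)"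
            unfolding z_def by (simp add: mat_poly_add_vec[OF B v] mat_poly_1_vec[OF B v] mat_poly_smult_vec[OF B v])
          moreover have "?P (e S) *\<^sub>v v = (if f \<in> S then v else 0\<^sub>v n)"
            by (rule e_vec[OF f'(1) v]) (simp add: v0)
          ultimately show ?thesis using v i by (auto simp: algebra_simps)
        qed
        have "(if f \<in> S then l * v $ i else v $ i) = (if f \<in> S' then l * v $ i else v $ i)"
          using zv[of S] zv[of S'] Pz by simp
        then show ?thesis using l i by (auto split: if_splits)
      qed
      then show "S = S'" using S(1,2) by (auto simp: Fd_def)
    qed
    show "A ` Fd \<subseteq> {A \<in> carrier (SL n). A ^\<^sub>m (?q - 1) = B ^\<^sub>m (?q - 1)}"
    proof clarify
      fix S assume S: "S \<in> Fd"
      have Ac: "A S \<in> carrier_mat n n" unfolding A_def using B by simp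
      \<comment> \<open>Taking determinants in \<open>z_one\<close> gives this; hence
        \<open>d ^ (q - 2)\<close> is the inverse of \<open>d\<close>.\<close>
      have "d ^ (?q - 1) = 1"
        using z_one[of S0] det_pow_P[of "z S0" "?q - 1"] S0 by (simp add: Fd_def)
      moreover have "?q - 1 = Suc (?q - 2)" using q by simp
      ultimately have "d * d ^ (?q - 2) = 1" by simp
      moreover have "det (?P (z S)) = d" "det (?P (z S0)) = d" using S S0 by (auto simp: Fd_def)
      ultimately have "det (A S) = 1"
        unfolding A_def det_mult_P det_pow_P mat_poly_X[OF B] detB by simp
      moreover have "A S ^\<^sub>m (?q - 1) = B ^\<^sub>m (?q - 1)"
      proof -
        have "A S ^\<^sub>m (?q - 1) = ?P ((?X * z S * z S0 ^ (?q - 2)) ^ (?q - 1))"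
          by (simp only: A_def mat_poly_power[OF B])
        also have "(?X * z S * z S0 ^ (?q - 2)) ^ (?q - 1) =
            ?X ^ (?q - 1) * z S ^ (?q - 1) * (z S0 ^ (?q - 1)) ^ (?q - 2)"
          by (simp only: power_mult_distrib power_mult[symmetric] mult.commute)
        also have "?P \<dots> = ?P (?X ^ (?q - 1)) * 1\<^sub>m n * (1\<^sub>m n ^\<^sub>m (?q - 2))"
          by (simp only: mat_poly_mult[OF B] z_one mat_poly_power[OF B, of "z S0 ^ (?q - 1)"])
        also have "1\<^sub>m n ^\<^sub>m (?q - 2) = (1\<^sub>m n :: 'a mat)"
          by (rule one_pow_mat)
        also have "?P (?X ^ (?q - 1)) * 1\<^sub>m n * 1\<^sub>m n = B ^\<^sub>m (?q - 1)"
          unfolding mat_poly_power[OF B] mat_poly_X[OF B]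
          by (simp only: right_mult_one_mat[OF pow_carrier_mat[OF B]])
        finally show ?thesis .
      qed
      ultimately show "A S \<in> carrier (SL n) \<and> A S ^\<^sub>m (?q - 1) = B ^\<^sub>m (?q - 1)"
        using Ac by (simp add: carrier_SL_iff)
    qed
    show "finite {A \<in> carrier (SL n). A ^\<^sub>m (?q - 1) = B ^\<^sub>m (?q - 1)}"
      by (rule finite_subset[OF _ finite_carrier_SL[of n]]) auto
  qed
  then have "?q * card Fd \<le> ?q * card {A \<in> carrier (SL n). A ^\<^sub>m (?q - 1) = B ^\<^sub>m (?q - 1)}"
    by (rule mult_le_mono2)
  with d show ?thesis unfolding Fd_def by linarith
qed

section \<open>The centre of the special linear group\<close>

lemma group_center_SL_entries:
  fixes z :: "'a :: field mat"
  assumes z: "z \<in> group_center (SL n)" and kl: "k < n" "l < n" "k \<noteq> l"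
  shows "z $$ (l, k) = 0" "z $$ (k, k) = z $$ (l, l)"
proof -
  have zc: "z \<in> carrier_mat n n" using z by (simp add: group_center_def carrier_SL_iff)
  \<comment> \<open>This is a transvection. Commuting with it equates a column operation on
    \<open>z\<close> with a row operation, and the entries \<open>(l, l)\<close> and
    \<open>(k, l)\<close> of that equation give the two claims.\<close>
  have "addrow_mat n 1 k l \<in> carrier (SL n :: 'a mat monoid)"
    using kl by (simp add: carrier_SL_iff det_addrow_mat)
  then have "z * addrow_mat n 1 k l = addrow_mat n 1 k l * z"
    using z by (auto simp: group_center_def mult_SL)
  then have eq: "addcol 1 l k z = addrow 1 k l z"
    using addcol_mat[OF zc kl(1)] addrow_mat[OF zc kl(2)] by simp
  have "addcol 1 l k z $$ (l, l) = addrow 1 k l z $$ (l, l)"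
    "addcol 1 l k z $$ (k, l) = addrow 1 k l z $$ (k, l)" by (simp_all add: eq)
  then show "z $$ (l, k) = 0" "z $$ (k, k) = z $$ (l, l)" using zc kl by auto
qed

text \<open>Central matrices are scalar, so the top left entry determines them.\<close>

lemma group_center_SL_card:
  assumes "n \<ge> 2"
  shows "card (group_center (SL n :: 'a :: {field, finite} mat monoid)) \<le> CARD('a)"
proof (rule card_inj_on_le)
  show "inj_on (\<lambda>z. z $$ (0, 0)) (group_center (SL n :: 'a mat monoid))"
  proof (rule inj_onI)
    fix z z' :: "'a mat"
    assume z: "z \<in> group_center (SL n)" and z': "z' \<in> group_center (SL n)" and eq: "z $$ (0, 0) = z' $$ (0, 0)"
    have c: "z \<in> carrier_mat n n" "z' \<in> carrier_mat n n"
      using z z' by (auto simp: group_center_def carrier_SL_iff)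
    have entry: "y $$ (i, j) = (if i = j then y $$ (0, 0) else 0)"
      if "y \<in> group_center (SL n)" "i < n" "j < n" for y :: "'a mat" and i j
    proof (cases "i = j")
      case True
      then show ?thesis
        using group_center_SL_entries(2)[OF that(1), of i 0] that by (cases "i = 0") auto
    next
      case False
      then show ?thesis using group_center_SL_entries(1)[OF that(1), of j i] that by simp
    qed
    show "z = z'"
    proof (rule eq_matI)
      fix i j assume "i < dim_row z'" "j < dim_col z'"
      then have "i < n" "j < n" using c by auto
      then show "z $$ (i, j) = z' $$ (i, j)"
        using entry[OF z, of i j] entry[OF z', of i j] eq by simp
    qed (use c in auto)
  qed
qed auto

text \<open>An element is good if each of \<open>K\<close> disjoint families contains a polynomial
  embedding into it. The power fibre through a good element has size at least
  \<open>2 ^ K / q\<close>, so good elements have few powers; at most \<open>K / L\<close> of the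
  group is bad. Each part is made at most \<open>eps / 2\<close>.\<close>

lemma SL_power_image_small:
  fixes eps :: real
  assumes q: "CARD('a :: {field, finite}) > 2" and eps: "eps > 0"
  shows "\<exists>n\<ge>2. real (card (power_word_image (CARD('a) - 1) (SL n :: 'a mat monoid)))
    \<le> eps * real (card (carrier (SL n :: 'a mat monoid)))"
proof -
  let ?q = "CARD('a)"
  obtain K where "2 * real ?q / eps < 2 ^ K" using real_arch_pow[of 2 "2 * real ?q / eps"] by auto
  then have K: "real ?q \<le> eps / 2 * 2 ^ K" using eps by (simp add: field_simps)
  \<comment> \<open>This makes \<open>K / L \<le> eps / 2\<close>; the added 1 keeps
    \<open>L\<close> positive when \<open>K = 0\<close>.\<close>
  define L where "L = 2 * (real K + 1) / eps"
  have L: "L > 0" "real K \<le> eps / 2 * L" using eps by (simp_all add: L_def)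
  \<comment> \<open>Only \<open>x\<close> belongs here; it is kept out of the families because its
    companion matrix is singular.\<close>
  define T0 where "T0 = {f :: 'a poly. f \<in> monic_irreducibles \<and> f dvd [:0, 1:]}"
  have "finite T0"
  proof (rule finite_subset[OF _ finite_monic_degree_le[of 1]])
    show "T0 \<subseteq> {g. lead_coeff g = 1 \<and> degree g \<le> 1}"
      using dvd_imp_degree_le[of _ "[:0, 1 :: 'a:]"] by (auto simp: T0_def monic_irreducibles_def)
  qed
  moreover have "T0 \<subseteq> monic_irreducibles" by (auto simp: T0_def)
  ultimately have "\<exists>T. (\<forall>i<K. finite (T i) \<and> T i \<subseteq> monic_irreducibles \<and> T i \<inter> T0 = {} \<and>
      (\<Sum>f\<in>T i. 1 / real ?q ^ degree f) \<ge> L) \<and> (\<forall>i<K. \<forall>j<K. i \<noteq> j \<longrightarrow> T i \<inter> T j = {})"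
    by (rule disjoint_irreducible_families)
  then obtain T where fam: "\<forall>i<K. finite (T i) \<and> T i \<subseteq> monic_irreducibles \<and> T i \<inter> T0 = {} \<and>
      (\<Sum>f\<in>T i. 1 / real ?q ^ degree f) \<ge> L"
    and disj: "\<forall>i<K. \<forall>j<K. i \<noteq> j \<longrightarrow> T i \<inter> T j = {}"
    by (elim exE conjE) (rule that)
  have T: "finite (T i)" "T i \<subseteq> monic_irreducibles" "T i \<inter> T0 = {}"
    "(\<Sum>f\<in>T i. 1 / real ?q ^ degree f) \<ge> L" if "i < K" for i
    using fam that by auto
  \<comment> \<open>The sum bounds every single \<open>2 * degree f\<close>; the summand 3 makes the
    bound strict and ensures \<open>n \<ge> 2\<close>.\<close>
  define n where "n = 3 + (\<Sum>f\<in>(\<Union>i<K. T i). 2 * degree f)"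
  have n: "2 * degree f < n" if "i < K" "f \<in> T i" for i f
  proof -
    have "2 * degree f \<le> (\<Sum>f\<in>(\<Union>i<K. T i). 2 * degree f)"
      using that T(1) by (intro member_le_sum) auto
    then show ?thesis by (simp add: n_def)
  qed
  define G where "G = carrier (SL n :: 'a mat monoid)"
  define pw where "pw = (\<lambda>A :: 'a mat. A ^\<^sub>m (?q - 1))"
  define bad where "bad = (\<lambda>i. {B \<in> G. \<forall>f\<in>T i. embeddings n B f = {}})"
  define good where "good = G - (\<Union>i<K. bad i)"
  have finG: "finite G" unfolding G_def by (rule finite_carrier_SL)
  have fin: "finite good" "finite (bad i)" for i
    using finG by (auto simp: good_def bad_def)
  have bad: "real (card (bad i)) * L \<le> real (card G)" if i: "i < K" for i
  proof -
    have "real (card (bad i)) * L \<le> real (card (bad i)) * (\<Sum>f\<in>T i. 1 / real ?q ^ degree f)"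
      using T(4)[OF i] by (intro mult_left_mono) auto
    also have "\<dots> \<le> real (card G)"
      unfolding bad_def G_def
    proof (rule card_no_embedding_le)
      show "\<And>f. f \<in> T i \<Longrightarrow> \<not> f dvd [:0, 1:]" using T(2,3)[OF i] by (auto simp: T0_def)
      show "0 < (\<Sum>f\<in>T i. 1 / real ?q ^ degree f)" using T(4)[OF i] L(1) by linarith
    qed (use T i n in auto)
    finally show ?thesis .
  qed
  have fibre: "2 ^ K \<le> ?q * card {A \<in> G. pw A = pw B}" if B: "B \<in> good" for B
  proof -
    have "\<forall>i<K. \<exists>f. f \<in> T i \<and> embeddings n B f \<noteq> {}"
      using B unfolding good_def bad_def by blast
    then obtain f where f: "\<And>i. i < K \<Longrightarrow> f i \<in> T i" "\<And>i. i < K \<Longrightarrow> embeddings n B (f i) \<noteq> {}"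
      by metis
    have "inj_on f {..<K}"
      using f(1) disj by (intro inj_onI) (metis IntI empty_iff lessThan_iff)
    then have "card (f ` {..<K}) = K" by (simp add: card_image)
    moreover have "2 ^ card (f ` {..<K}) \<le> ?q * card {A \<in> carrier (SL n). A ^\<^sub>m (?q - 1) = B ^\<^sub>m (?q - 1)}"
    proof (rule power_fibre_card[OF _ q])
      show "B \<in> carrier (SL n)" using B by (simp add: good_def G_def)
      show "f ` {..<K} \<subseteq> monic_irreducibles" using f(1) T(2) by auto
    qed (use f(2) in auto)
    ultimately show ?thesis by (simp add: G_def pw_def)
  qed
  \<comment> \<open>Fibres over distinct powers are disjoint subsets of \<open>G\<close>, and each
    has at least \<open>2 ^ K / q\<close> elements.\<close>
  have "card (pw ` good) * 2 ^ K \<le> ?q * card G"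
  proof -
    have "card (pw ` good) * 2 ^ K = (\<Sum>y\<in>pw ` good. 2 ^ K)" by simp
    also have "\<dots> \<le> (\<Sum>y\<in>pw ` good. ?q * card {A \<in> G. pw A = y})"
      using fibre by (intro sum_mono) auto
    also have "\<dots> = ?q * card (\<Union>y\<in>pw ` good. {A \<in> G. pw A = y})"
      using fin finG by (subst card_UN_disjoint) (auto simp: sum_distrib_left)
    also have "\<dots> \<le> ?q * card G"
      using finG by (intro mult_left_mono card_mono) auto
    finally show ?thesis .
  qed
  then have "real (card (pw ` good)) * 2 ^ K \<le> real ?q * real (card G)"
    using of_nat_mono[where 'a = real] by fastforce
  also have "\<dots> \<le> eps / 2 * 2 ^ K * real (card G)" using K by (intro mult_right_mono) auto
  also have "\<dots> = eps / 2 * real (card G) * 2 ^ K" by (simp only: mult_ac)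
  finally have good_le: "real (card (pw ` good)) \<le> eps / 2 * real (card G)"
    by (rule mult_right_le_imp_le) simp
  have bad_le: "(\<Sum>i<K. real (card (bad i))) \<le> eps / 2 * real (card G)"
  proof -
    have "L * (\<Sum>i<K. real (card (bad i))) \<le> (\<Sum>i<K. real (card G))"
      unfolding sum_distrib_left using bad by (intro sum_mono) (simp add: mult.commute)
    also have "\<dots> = real K * real (card G)" by simp
    also have "\<dots> \<le> eps / 2 * L * real (card G)" using L(2) by (intro mult_right_mono) auto
    finally have "L * (\<Sum>i<K. real (card (bad i))) \<le> L * (eps / 2 * real (card G))" by (simp add: mult_ac)
    then show ?thesis using L(1) by simp
  qed
  have "power_word_image (?q - 1) (SL n :: 'a mat monoid) \<subseteq> pw ` good \<union> pw ` (\<Union>i<K. bad i)"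
  proof
    fix y assume "y \<in> power_word_image (?q - 1) (SL n :: 'a mat monoid)"
    then obtain A where "A \<in> G" "y = pw A"
      by (auto simp: power_word_image_def SL_pow pw_def G_def)
    then show "y \<in> pw ` good \<union> pw ` (\<Union>i<K. bad i)" unfolding good_def by blast
  qed
  then have "card (power_word_image (?q - 1) (SL n :: 'a mat monoid)) \<le> card (pw ` good \<union> pw ` (\<Union>i<K. bad i))"
    using fin by (intro card_mono) auto
  also have "\<dots> \<le> card (pw ` good) + card (pw ` (\<Union>i<K. bad i))" by (rule card_Un_le)
  also have "card (pw ` (\<Union>i<K. bad i)) \<le> card (\<Union>i<K. bad i)"
    using fin by (intro card_image_le) auto
  also have "\<dots> \<le> (\<Sum>i<K. card (bad i))" by (rule card_UN_le) simp
  finally have "real (card (power_word_image (?q - 1) (SL n :: 'a mat monoid))) \<le>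
    real (card (pw ` good)) + (\<Sum>i<K. real (card (bad i)))"
    by (simp flip: of_nat_sum of_nat_add)
  also have "\<dots> \<le> eps * real (card G)" using good_le bad_le by (simp add: field_simps)
  finally show ?thesis unfolding G_def by (intro exI[of _ n]) (auto simp: n_def)
qed

text \<open>The projection maps the power image of \<open>SL n\<close> onto that of
  \<open>PSL n\<close>, and the centre has order at most \<open>q\<close>, so the density of the
  image grows by at most a factor \<open>q\<close>.\<close>

theorem theorem1p5:
  fixes q M :: nat
  assumes "primepow q" and "q > 2"
    and "CARD('a :: {field, finite}) = q"
    and "M = q - 1"
  shows "\<forall>(N :: nat) (c :: real). c > 0 \<longrightarrow>
    (\<exists>n \<ge> 2. let G = (PSL n :: 'a mat set monoid) in
      order G \<ge> N \<and> real (card (power_word_image M G)) < c * real (order G))"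
proof (intro allI impI)
  fix N :: nat and c :: real assume c: "c > 0"
  \<comment> \<open>Bounding the constant by \<open>1 / (N + 1)\<close> forces the group to be
    large: the image has at least one element, so \<open>1 < c' * |G|\<close> and
    \<open>|G| > N + 1\<close>.\<close>
  define c' where "c' = min c (1 / (real N + 1))"
  have c': "c' > 0" "c' \<le> c" "c' * (real N + 1) \<le> 1"
    using c by (auto simp: c'_def min_def field_simps)
  have q: "q > 0" "M = CARD('a) - 1" using assms by auto
  \<comment> \<open>The \<open>q\<close> in the denominator pays for the centre, and the 2 makes the
    final inequality strict.\<close>
  obtain n where n: "n \<ge> 2" and small: "real (card (power_word_image M (SL n :: 'a mat monoid)))
    \<le> c' / (2 * real q) * real (card (carrier (SL n :: 'a mat monoid)))"
    using SL_power_image_small[where 'a = 'a, of "c' / (2 * real q)"] assms c'(1) q by auto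
  interpret group "SL n :: 'a mat monoid" by (rule group_SL)
  define Z where "Z = group_center (SL n :: 'a mat monoid)"
  interpret Z: normal Z "SL n :: 'a mat monoid"
    unfolding Z_def by (rule group_center_normal)
  let ?S = "SL n :: 'a mat monoid" and ?G = "PSL n :: 'a mat set monoid"
  have G: "?G = ?S Mod Z" by (simp add: PSL_def Z_def)
  have grpG: "group ?G" by (rule group_PSL)
  have ord: "order ?G * card Z = card (carrier ?S)"
    using lagrange[OF Z.is_subgroup] by (simp add: G order_def FactGroup_def)
  have cardZ: "card Z \<le> q" unfolding Z_def using group_center_SL_card[OF n, where 'a = 'a] assms by simp
  have finS: "finite (carrier ?S)" by (rule finite_carrier_SL)
  have image: "power_word_image M ?G = (\<lambda>a. Z #>\<^bsub>?S\<^esub> a) ` power_word_image M ?S"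
  proof -
    have pow: "(Z #>\<^bsub>?S\<^esub> a) [^]\<^bsub>?G\<^esub> M = Z #>\<^bsub>?S\<^esub> (a [^]\<^bsub>?S\<^esub> M)" if "a \<in> carrier ?S" for a
      using hom_nat_pow[OF Z.r_coset_hom_Mod that is_group, of M] grpG by (simp add: G)
    have "carrier ?G = (\<lambda>a. Z #>\<^bsub>?S\<^esub> a) ` carrier ?S"
      by (auto simp: G FactGroup_def RCOSETS_def)
    then show ?thesis
      unfolding power_word_image_def by (auto simp: pow) (metis image_eqI pow)+
  qed
  have fin: "finite (power_word_image M ?S)"
    by (rule finite_subset[OF _ finS]) (auto simp: power_word_image_def)
  have "order ?G > 0"
    using ord finS one_closed by (metis card_gt_0_iff empty_iff gr0I mult_0)
  have "real (card (power_word_image M ?G)) \<le> real (card (power_word_image M ?S))"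
    unfolding image using card_image_le[OF fin] by simp
  also note small
  also have "c' / (2 * real q) * real (card (carrier ?S)) \<le> c' / (2 * real q) * (real (order ?G) * real q)"
    unfolding ord[symmetric] of_nat_mult using cardZ c'(1) by (intro mult_left_mono) auto
  also have "\<dots> < c' * real (order ?G)"
    using q c'(1) \<open>order ?G > 0\<close> by (simp add: field_simps)
  finally have less: "real (card (power_word_image M ?G)) < c' * real (order ?G)" .
  have "power_word_image M ?S \<noteq> {}" using one_closed by (auto simp: power_word_image_def)
  then have "power_word_image M ?G \<noteq> {}" by (simp add: image)
  then have "1 \<le> real (card (power_word_image M ?G))"
    using fin by (simp add: image Suc_le_eq card_gt_0_iff)
  with less have "1 < c' * real (order ?G)" by linarith
  then have "c' * (real N + 1) < c' * real (order ?G)" using c'(3) by linarith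
  then have "real N + 1 < real (order ?G)" using c'(1) by simp
  moreover have "c' * real (order ?G) \<le> c * real (order ?G)" using c'(2) by (intro mult_right_mono) auto
  ultimately show "\<exists>n \<ge> 2. let G = (PSL n :: 'a mat set monoid) in
      order G \<ge> N \<and> real (card (power_word_image M G)) < c * real (order G)"
    using n less unfolding Let_def by (intro exI[of _ n] conjI) linarith+
qed

end
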